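(* Let $G$ be a finite, connected, undirected graph with at least two vertices and positive edge weights. Then there are two disjoint nonempty sets of vertices $S_1,S_2\subseteq V(G)$ with $$\texttt{Reff}_G(S_1,S_2)\ge \frac{1}{25600\,\lambda_G\min(\mathrm{vol}_G(S_1),\mathrm{vol}_G(S_2))}.$$ Furthermore, for any two disjoint nonempty sets $S_1',S_2'\subseteq V(G)$, $$\texttt{Reff}_G(S_1',S_2')\le \frac{2}{\lambda_G\min(\mathrm{vol}_G(S_1'),\mathrm{vol}_G(S_2'))}.$$
   Context: For edge weights $c_e>0$, $c_v:=\sum_{e\ni v}c_e$ is the weighted degree of $v$ and $\mathrm{vol}_G(A):=\sum_{v\in A}c_v$. Let $D_G$ be the diagonal degree matrix, $A_G$ the weighted adjacency matrix, $L_G:=D_G-A_G$ the Laplacian, and $N_G:=D_G^{-1/2}L_GD_G^{-1/2}$ the normalized Laplacian; $\lambda_G$ is the smallest nonzero eigenvalue of $N_G$. For disjoint nonempty $S_1,S_2\subseteq V(G)$, let $H$ be the graph obtained from $G$ by identifying all vertices of $S_1$ into a single vertex $s_1$ and all vertices of $S_2$ into a single vertex $s_2$ (each edge $\{u,v\}$ of $G$ becomes an edge between the images of $u$ and $v$, with the same weight). Then $\texttt{Reff}_G(S_1,S_2):=\chi^T L_H^{\dagger}\chi$ where $\chi:=\mathbf{1}_{\{s_1\}}-\mathbf{1}_{\{s_2\}}$ and $L_H^\dagger$ is the Moore–Penrose pseudoinverse of the Laplacian of $H$; i.e., the effective resistance between $s_1$ and $s_2$ in the electrical network $H$ with conductances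 equal to edge weights. *)

theory Defs
  imports Complex_Main
begin

text \<open>
  Edge-weighted undirected multigraphs. The endpoints of an edge form a set: two elements for
  an ordinary edge, one for a loop. Loops (and new parallel edges) arise when vertices are
  identified; \<open>weighted_graph\<close> below excludes loops but not parallel edges.
\<close>

record ('v, 'e) wgraph =
  verts :: "'v set"
  edges :: "'e set"
  ends  :: "'e \<Rightarrow> 'v set"
  wt    :: "'e \<Rightarrow> real"

definition weighted_graph :: "('v, 'e) wgraph \<Rightarrow> bool" where
  "weighted_graph G \<longleftrightarrow> finite (verts G) \<and> finite (edges G) \<and>
     (\<forall>e\<in>edges G. ends G e \<subseteq> verts G \<and> card (ends G e) = 2 \<and> wt G e > 0)"

definition adjacent :: "('v, 'e) wgraph \<Rightarrow> 'v \<Rightarrow> 'v \<Rightarrow> bool" where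
  "adjacent G u v \<longleftrightarrow> (\<exists>e\<in>edges G. ends G e = {u, v})"

definition connected_graph :: "('v, 'e) wgraph \<Rightarrow> bool" where
  "connected_graph G \<longleftrightarrow> (\<forall>u\<in>verts G. \<forall>v\<in>verts G. (adjacent G)\<^sup>*\<^sup>* u v)"

definition wdegree :: "('v, 'e) wgraph \<Rightarrow> 'v \<Rightarrow> real" where
  "wdegree G v = (\<Sum>e | e \<in> edges G \<and> v \<in> ends G e. wt G e)"

definition vol :: "('v, 'e) wgraph \<Rightarrow> 'v set \<Rightarrow> real" where
  "vol G A = (\<Sum>v\<in>A. wdegree G v)"

text \<open>
  A real matrix with rows and columns indexed by a finite set \<open>V\<close> is a function
  \<open>'v \<Rightarrow> 'v \<Rightarrow> real\<close>, of which only the entries in \<open>V \<times> V\<close> matter.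
\<close>

type_synonym 'v mtx = "'v \<Rightarrow> 'v \<Rightarrow> real"

definition mtx_mult :: "'v set \<Rightarrow> 'v mtx \<Rightarrow> 'v mtx \<Rightarrow> 'v mtx" where
  "mtx_mult V A B = (\<lambda>u v. \<Sum>w\<in>V. A u w * B w v)"

definition mtx_eq :: "'v set \<Rightarrow> 'v mtx \<Rightarrow> 'v mtx \<Rightarrow> bool" where
  "mtx_eq V A B \<longleftrightarrow> (\<forall>u\<in>V. \<forall>v\<in>V. A u v = B u v)"

definition mtx_transpose :: "'v mtx \<Rightarrow> 'v mtx" where
  "mtx_transpose A = (\<lambda>u v. A v u)"

definition diag_mtx :: "('v \<Rightarrow> real) \<Rightarrow> 'v mtx" where
  "diag_mtx d = (\<lambda>u v. if u = v then d u else 0)"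

definition mtx_eigenvalue :: "'v set \<Rightarrow> 'v mtx \<Rightarrow> real \<Rightarrow> bool" where
  "mtx_eigenvalue V A \<mu> \<longleftrightarrow>
     (\<exists>x. (\<exists>v\<in>V. x v \<noteq> 0) \<and> (\<forall>u\<in>V. (\<Sum>v\<in>V. A u v * x v) = \<mu> * x u))"

text \<open>
  The four Penrose conditions; the first conjunct fixes the irrelevant entries of \<open>X\<close>, so that
  \<open>X\<close> is unique as a function.
\<close>

definition is_pinv :: "'v set \<Rightarrow> 'v mtx \<Rightarrow> 'v mtx \<Rightarrow> bool" where
  "is_pinv V A X \<longleftrightarrow>
     (\<forall>u v. u \<notin> V \<or> v \<notin> V \<longrightarrow> X u v = 0) \<and>
     mtx_eq V (mtx_mult V (mtx_mult V A X) A) A \<and>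
     mtx_eq V (mtx_mult V (mtx_mult V X A) X) X \<and>
     mtx_eq V (mtx_transpose (mtx_mult V A X)) (mtx_mult V A X) \<and>
     mtx_eq V (mtx_transpose (mtx_mult V X A)) (mtx_mult V X A)"

definition pinv :: "'v set \<Rightarrow> 'v mtx \<Rightarrow> 'v mtx" where
  "pinv V A = (THE X. is_pinv V A X)"

definition degree_mtx :: "('v, 'e) wgraph \<Rightarrow> 'v mtx" where
  "degree_mtx G = diag_mtx (wdegree G)"

text \<open>
  A loop at \<open>v\<close> counts once in \<open>wdegree G v\<close> and once in the diagonal entry \<open>adjacency_mtx G v v\<close>
  (as \<open>{v, v} = {v}\<close>), hence contributes nothing to the Laplacian.
\<close>

definition adjacency_mtx :: "('v, 'e) wgraph \<Rightarrow> 'v mtx" where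
  "adjacency_mtx G = (\<lambda>u v. \<Sum>e | e \<in> edges G \<and> ends G e = {u, v}. wt G e)"

definition laplacian :: "('v, 'e) wgraph \<Rightarrow> 'v mtx" where
  "laplacian G = (\<lambda>u v. degree_mtx G u v - adjacency_mtx G u v)"

definition degree_inv_sqrt_mtx :: "('v, 'e) wgraph \<Rightarrow> 'v mtx" where
  "degree_inv_sqrt_mtx G = diag_mtx (\<lambda>v. 1 / sqrt (wdegree G v))"

definition normalized_laplacian :: "('v, 'e) wgraph \<Rightarrow> 'v mtx" where
  "normalized_laplacian G =
     mtx_mult (verts G) (mtx_mult (verts G) (degree_inv_sqrt_mtx G) (laplacian G))
       (degree_inv_sqrt_mtx G)"

definition spectral_gap :: "('v, 'e) wgraph \<Rightarrow> real" where
  "spectral_gap G =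
     (LEAST \<mu>. mtx_eigenvalue (verts G) (normalized_laplacian G) \<mu> \<and> \<mu> \<noteq> 0)"

text \<open>
  Vertices of the graph with \<open>S1\<close> and \<open>S2\<close> identified are sets of vertices of \<open>G\<close>: the set \<open>S1\<close>
  is the vertex \<open>s1\<close>, the set \<open>S2\<close> is \<open>s2\<close>, and any other vertex \<open>v\<close> becomes \<open>{v}\<close>.
\<close>

definition ident :: "'v set \<Rightarrow> 'v set \<Rightarrow> 'v \<Rightarrow> 'v set" where
  "ident S1 S2 v = (if v \<in> S1 then S1 else if v \<in> S2 then S2 else {v})"

definition identify :: "('v, 'e) wgraph \<Rightarrow> 'v set \<Rightarrow> 'v set \<Rightarrow> ('v set, 'e) wgraph" where
  "identify G S1 S2 =
     \<lparr>verts = ident S1 S2 ` verts G, edges = edges G,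
      ends = (\<lambda>e. ident S1 S2 ` ends G e), wt = wt G\<rparr>"

definition Reff :: "('v, 'e) wgraph \<Rightarrow> 'v set \<Rightarrow> 'v set \<Rightarrow> real" where
  "Reff G S1 S2 =
     (let H = identify G S1 S2;
          \<chi> = (\<lambda>s. of_bool (s = S1) - of_bool (s = S2))
      in \<Sum>s\<in>verts H. \<Sum>t\<in>verts H. \<chi> s * pinv (verts H) (laplacian H) s t * \<chi> t)"

end

theory Submission
  imports Defs "HOL-Analysis.Function_Topology" "HOL-Analysis.Convex"
begin

text \<open>
  Write \<open>E\<close> for the Dirichlet energy. The resistance \<open>R = Reff G S1 S2\<close> is the energy of the
  potential \<open>f\<close> of a unit current from \<open>S1\<close> to \<open>S2\<close>, whose values on \<open>S1\<close> and \<open>S2\<close> differ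
  by \<open>R\<close>, and \<open>E(g, f) = \<gamma> - \<delta>\<close> for every \<open>g\<close> equal to \<open>\<gamma>\<close> on \<open>S1\<close> and to \<open>\<delta>\<close> on \<open>S2\<close>.

  Upper bound: the degree-weighted variance of \<open>f\<close> is at least \<open>R\<^sup>2 / 2\<close> times the smaller volume,
  so the Poincare inequality for the spectral gap \<open>\<lambda>\<close> bounds \<open>R\<^sup>2\<close> in terms of \<open>E(f, f) = R\<close>.

  Lower bound: by Cauchy-Schwarz, \<open>R \<ge> (\<gamma> - \<delta>)\<^sup>2 / E(g, g)\<close>. Subtract from an eigenfunction for \<open>\<lambda>\<close>
  its weighted median; the positive or the negative part \<open>h\<close> of the result is supported on at
  most half of the volume and still has Rayleigh quotient at most \<open>\<lambda>\<close>. Cut \<open>h\<close> into dyadic slices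
  between the levels \<open>t\<close> and \<open>2 t\<close>. The energies of the slices add up to at most \<open>E(h, h)\<close>, while
  the squared norm of \<open>h\<close> is at most the sum of \<open>16 t\<^sup>2 vol {h \<ge> 2 t}\<close>. Hence some slice \<open>g\<close> has
  \<open>E(g, g) \<le> 16 \<lambda> t\<^sup>2 vol {h \<ge> 2 t}\<close>, and one takes \<open>S1 = {h \<ge> 2 t}\<close>, \<open>S2 = {h \<le> t}\<close>;
  this gives the constant 16 in place of 25600.
\<close>

section \<open>Positive definite linear systems and uniqueness of the Moore-Penrose inverse\<close>

lemma sum_of_bool_mult:
  fixes x :: "'v \<Rightarrow> real"
  assumes "finite V" "w \<in> V"
  shows "(\<Sum>v\<in>V. of_bool (v = w) * x v) = x w"
    and "(\<Sum>v\<in>V. of_bool (w = v) * x v) = x w"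
    and "(\<Sum>v\<in>V. x v * of_bool (v = w)) = x w"
  using assms by (simp_all add: of_bool_def if_distrib if_distribR cong: if_cong)

text \<open>Gaussian elimination: testing with the indicator of \<open>a\<close> shows that the
  pivot \<open>M a a\<close> is positive, and the Schur complement \<open>M'\<close> inherits
  positivity on the remaining indices.\<close>

lemma positive_definite_solvable:
  fixes M :: "'v mtx"
  assumes "finite V"
    and "\<And>x. \<exists>v\<in>V. x v \<noteq> 0 \<Longrightarrow> 0 < (\<Sum>u\<in>V. x u * (\<Sum>v\<in>V. M u v * x v))"
  shows "\<exists>x. \<forall>u\<in>V. (\<Sum>v\<in>V. M u v * x v) = b u"
  using assms
proof (induction V arbitrary: M b rule: finite_induct)
  case (insert a F)
  have Maa: "M a a > 0"
    using insert.prems[of "\<lambda>v. of_bool (v = a)"] insert.hyps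
    by (simp add: of_bool_def if_distrib if_distribR cong: if_cong)
  define M' where "M' = (\<lambda>u v. M u v - M u a * M a v / M a a)"
  have elim: "(\<Sum>v\<in>F. M' u v * x v)
      = M u a * (- (\<Sum>v\<in>F. M a v * x v) / M a a) + (\<Sum>v\<in>F. M u v * x v)" for u x
    by (simp add: M'_def left_diff_distrib sum_subtractf sum_distrib_left sum_divide_distrib
        mult.assoc)
  have "\<exists>x. \<forall>u\<in>F. (\<Sum>v\<in>F. M' u v * x v) = b u - M u a * b a / M a a"
  proof (rule insert.IH)
    fix x :: "'v \<Rightarrow> real" assume x: "\<exists>v\<in>F. x v \<noteq> 0"
    \<comment> \<open>The new coordinate is chosen to make row \<open>a\<close> of \<open>M\<close>
      vanish at \<open>y\<close>; the form of \<open>M\<close> at \<open>y\<close> then equals the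
      form of \<open>M'\<close> at \<open>x\<close>.\<close>
    define y where "y = x(a := - (\<Sum>v\<in>F. M a v * x v) / M a a)"
    have yF: "(\<Sum>v\<in>F. M u v * y v) = (\<Sum>v\<in>F. M u v * x v)" for u
      using insert.hyps by (intro sum.cong) (auto simp: y_def)
    have row_a: "(\<Sum>v\<in>insert a F. M a v * y v) = 0"
      using insert.hyps Maa by (simp add: yF) (simp add: y_def)
    have row: "(\<Sum>v\<in>insert a F. M u v * y v) = (\<Sum>v\<in>F. M' u v * x v)" for u
      using insert.hyps by (simp add: yF elim) (simp add: y_def)
    have "\<exists>v\<in>insert a F. y v \<noteq> 0"
      using x insert.hyps by (auto simp: y_def)
    from insert.prems[OF this]
    have "0 < y a * (\<Sum>v\<in>insert a F. M a v * y v)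
        + (\<Sum>u\<in>F. y u * (\<Sum>v\<in>insert a F. M u v * y v))"
      using insert.hyps by simp
    also have "\<dots> = (\<Sum>u\<in>F. y u * (\<Sum>v\<in>F. M' u v * x v))"
      unfolding row_a by (simp add: row)
    also have "\<dots> = (\<Sum>u\<in>F. x u * (\<Sum>v\<in>F. M' u v * x v))"
      using insert.hyps by (intro sum.cong) (auto simp: y_def)
    finally show "0 < (\<Sum>u\<in>F. x u * (\<Sum>v\<in>F. M' u v * x v))" .
  qed
  then obtain x where x: "\<And>u. u \<in> F \<Longrightarrow> (\<Sum>v\<in>F. M' u v * x v) = b u - M u a * b a / M a a"
    by blast
  \<comment> \<open>Back substitution: equation \<open>a\<close> is solved for the coordinate at
    \<open>a\<close>.\<close>
  define y where "y = x(a := (b a - (\<Sum>v\<in>F. M a v * x v)) / M a a)"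
  have yF: "(\<Sum>v\<in>F. M u v * y v) = (\<Sum>v\<in>F. M u v * x v)" for u
    using insert.hyps by (intro sum.cong) (auto simp: y_def)
  have "(\<Sum>v\<in>insert a F. M u v * y v) = b u" if "u \<in> insert a F" for u
  proof (cases "u = a")
    case True
    then show ?thesis using insert.hyps Maa by (simp add: yF) (simp add: y_def)
  next
    case False
    with that x[of u] show ?thesis using insert.hyps Maa
      by (simp add: yF elim) (simp add: y_def diff_divide_distrib algebra_simps)
  qed
  then show ?case by blast
qed simp

lemma mtx_mult_assoc: "mtx_mult V (mtx_mult V A B) C = mtx_mult V A (mtx_mult V B C)"
  unfolding mtx_mult_def
  by (intro ext) (simp add: sum_distrib_left sum_distrib_right mult.assoc, rule sum.swap)

lemma mtx_transpose_mult:
  "mtx_transpose (mtx_mult V A B) = mtx_mult V (mtx_transpose B) (mtx_transpose A)"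
  by (simp add: mtx_transpose_def mtx_mult_def mult.commute)

lemma mtx_eq_mult:
  "mtx_eq V A A' \<Longrightarrow> mtx_eq V B B' \<Longrightarrow> mtx_eq V (mtx_mult V A B) (mtx_mult V A' B')"
  by (simp add: mtx_eq_def mtx_mult_def)

lemma mtx_eq_refl: "mtx_eq V A A"
  by (simp add: mtx_eq_def)

lemma mtx_eq_sym: "mtx_eq V A B \<Longrightarrow> mtx_eq V B A"
  by (simp add: mtx_eq_def)

lemma mtx_eq_trans [trans]: "mtx_eq V A B \<Longrightarrow> mtx_eq V B C \<Longrightarrow> mtx_eq V A C"
  by (simp add: mtx_eq_def)

lemma mtx_eq_transpose: "mtx_eq V A B \<Longrightarrow> mtx_eq V (mtx_transpose A) (mtx_transpose B)"
  by (simp add: mtx_eq_def mtx_transpose_def)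

text \<open>Penrose's argument: symmetry of the products gives \<open>X A = Y A\<close> and
  \<open>A X = A Y\<close>, and then \<open>X = X A X = Y A X = Y A Y = Y\<close>.\<close>

lemma is_pinv_unique:
  assumes X: "is_pinv V A X" and Y: "is_pinv V A Y"
  shows "X = Y"
proof -
  let ?m = "mtx_mult V" and ?T = mtx_transpose
  note X' = X[unfolded is_pinv_def] and Y' = Y[unfolded is_pinv_def]
  have left: "mtx_eq V (?m X A) (?m Y A)"
  proof -
    have "mtx_eq V (?m X A) (?T (?m X A))"
      using X' by (blast intro: mtx_eq_sym)
    also have "mtx_eq V (?T (?m X A)) (?T (?m (?m X A) (?m Y A)))"
    proof (rule mtx_eq_transpose)
      have "mtx_eq V (?m X A) (?m X (?m (?m A Y) A))"
        using Y' by (blast intro: mtx_eq_mult mtx_eq_refl mtx_eq_sym)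
      then show "mtx_eq V (?m X A) (?m (?m X A) (?m Y A))"
        by (simp add: mtx_mult_assoc)
    qed
    also have "mtx_eq V (?T (?m (?m X A) (?m Y A))) (?m (?m Y A) (?m X A))"
      unfolding mtx_transpose_mult[of V "?m X A"] using X' Y' by (blast intro: mtx_eq_mult)
    also have "mtx_eq V (?m (?m Y A) (?m X A)) (?m Y A)"
    proof -
      have "mtx_eq V (?m Y (?m (?m A X) A)) (?m Y A)"
        using X' by (blast intro: mtx_eq_mult mtx_eq_refl)
      then show ?thesis by (simp add: mtx_mult_assoc)
    qed
    finally show ?thesis .
  qed
  have right: "mtx_eq V (?m A X) (?m A Y)"
  proof -
    have "mtx_eq V (?m A X) (?T (?m A X))"
      using X' by (blast intro: mtx_eq_sym)
    also have "mtx_eq V (?T (?m A X)) (?T (?m (?m A Y) (?m A X)))"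
    proof (rule mtx_eq_transpose)
      have "mtx_eq V (?m A X) (?m (?m (?m A Y) A) X)"
        using Y' by (blast intro: mtx_eq_mult mtx_eq_refl mtx_eq_sym)
      then show "mtx_eq V (?m A X) (?m (?m A Y) (?m A X))"
        by (simp add: mtx_mult_assoc)
    qed
    also have "mtx_eq V (?T (?m (?m A Y) (?m A X))) (?m (?m A X) (?m A Y))"
      unfolding mtx_transpose_mult[of V "?m A Y"] using X' Y' by (blast intro: mtx_eq_mult)
    also have "mtx_eq V (?m (?m A X) (?m A Y)) (?m A Y)"
    proof -
      have "mtx_eq V (?m (?m (?m A X) A) Y) (?m A Y)"
        using X' by (blast intro: mtx_eq_mult mtx_eq_refl)
      then show ?thesis by (simp add: mtx_mult_assoc)
    qed
    finally show ?thesis .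
  qed
  have "mtx_eq V X (?m (?m X A) X)"
    using X' by (blast intro: mtx_eq_sym)
  also have "mtx_eq V (?m (?m X A) X) (?m (?m Y A) X)"
    by (intro mtx_eq_mult left mtx_eq_refl)
  also have "?m (?m Y A) X = ?m Y (?m A X)"
    by (rule mtx_mult_assoc)
  also have "mtx_eq V (?m Y (?m A X)) (?m Y (?m A Y))"
    by (intro mtx_eq_mult right mtx_eq_refl)
  also have "?m Y (?m A Y) = ?m (?m Y A) Y"
    by (simp add: mtx_mult_assoc)
  also have "mtx_eq V (?m (?m Y A) Y) Y"
    using Y' by blast
  finally have "mtx_eq V X Y" .
  moreover have "X u v = 0" "Y u v = 0" if "u \<notin> V \<or> v \<notin> V" for u v
    using X' Y' that by blast+
  ultimately show ?thesis
    unfolding mtx_eq_def by (metis ext)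
qed

lemma pinv_eqI: "is_pinv V A X \<Longrightarrow> pinv V A = X"
  unfolding pinv_def by (blast intro: the_equality is_pinv_unique)

section \<open>Dirichlet energy, Laplacian and its pseudoinverse\<close>

text \<open>The orientation of the edges is arbitrary. The case \<open>p e = q e\<close> is allowed,
  so the locale also covers the graphs with loops that \<open>identify\<close> produces.\<close>

locale oriented_graph =
  fixes K :: "('v, 'e) wgraph" and p q :: "'e \<Rightarrow> 'v"
  assumes finite_verts: "finite (verts K)"
    and finite_edges: "finite (edges K)"
    and verts_nonempty: "verts K \<noteq> {}"
    and ends_eq: "e \<in> edges K \<Longrightarrow> ends K e = {p e, q e}"
    and p_in_verts: "e \<in> edges K \<Longrightarrow> p e \<in> verts K"
    and q_in_verts: "e \<in> edges K \<Longrightarrow> q e \<in> verts K"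
    and wt_pos: "e \<in> edges K \<Longrightarrow> wt K e > 0"
    and connected: "connected_graph K"
begin

definition energy :: "('v \<Rightarrow> real) \<Rightarrow> ('v \<Rightarrow> real) \<Rightarrow> real" where
  "energy x y = (\<Sum>e\<in>edges K. wt K e * ((x (p e) - x (q e)) * (y (p e) - y (q e))))"

definition lap :: "('v \<Rightarrow> real) \<Rightarrow> 'v \<Rightarrow> real" where
  "lap x u = (\<Sum>v\<in>verts K. laplacian K u v * x v)"

text \<open>The factorization of the Laplacian through the signed incidence vectors, indicator of
  \<open>p e\<close> minus indicator of \<open>q e\<close>. For a loop this vector is zero, in
  agreement with the cancellation of its degree and adjacency entries.\<close>

lemma laplacian_edge_sum:
  "laplacian K u v = (\<Sum>e\<in>edges K. wt K e *
     ((of_bool (u = p e) - of_bool (u = q e)) * (of_bool (v = p e) - of_bool (v = q e))))"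
proof -
  have "laplacian K u v = (\<Sum>e\<in>edges K.
      of_bool (u = v) * (if u \<in> ends K e then wt K e else 0)
        - (if ends K e = {u, v} then wt K e else 0))"
    using finite_edges
    by (simp add: laplacian_def degree_mtx_def diag_mtx_def adjacency_mtx_def wdegree_def
        sum.inter_filter sum_subtractf)
  also have "\<dots> = (\<Sum>e\<in>edges K. wt K e *
     ((of_bool (u = p e) - of_bool (u = q e)) * (of_bool (v = p e) - of_bool (v = q e))))"
    by (intro sum.cong) (auto simp: ends_eq doubleton_eq_iff)
  finally show ?thesis .
qed

lemma lap_edge_sum:
  "lap x u = (\<Sum>e\<in>edges K. wt K e *
     ((of_bool (u = p e) - of_bool (u = q e)) * (x (p e) - x (q e))))"
proof -
  have "lap x u = (\<Sum>v\<in>verts K. \<Sum>e\<in>edges K. wt K e *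
     ((of_bool (u = p e) - of_bool (u = q e)) * ((of_bool (v = p e) - of_bool (v = q e)) * x v)))"
    by (simp add: lap_def laplacian_edge_sum sum_distrib_right mult.assoc)
  also have "\<dots> = (\<Sum>e\<in>edges K. \<Sum>v\<in>verts K. wt K e *
     ((of_bool (u = p e) - of_bool (u = q e)) * ((of_bool (v = p e) - of_bool (v = q e)) * x v)))"
    by (rule sum.swap)
  also have "\<dots> = (\<Sum>e\<in>edges K. wt K e *
     ((of_bool (u = p e) - of_bool (u = q e)) * (x (p e) - x (q e))))"
  proof (intro sum.cong refl)
    fix e assume e: "e \<in> edges K"
    have "(\<Sum>v\<in>verts K. (of_bool (v = p e) - of_bool (v = q e)) * x v) = x (p e) - x (q e)"
      using e finite_verts
      by (simp add: left_diff_distrib sum_subtractf sum_of_bool_mult p_in_verts q_in_verts)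
    then show "(\<Sum>v\<in>verts K. wt K e *
       ((of_bool (u = p e) - of_bool (u = q e)) * ((of_bool (v = p e) - of_bool (v = q e)) * x v)))
      = wt K e * ((of_bool (u = p e) - of_bool (u = q e)) * (x (p e) - x (q e)))"
      by (simp flip: sum_distrib_left)
  qed
  finally show ?thesis .
qed

text \<open>Summation by parts, the discrete Green formula.\<close>

lemma sum_lap: "(\<Sum>u\<in>verts K. x u * lap y u) = energy x y"
proof -
  have "(\<Sum>u\<in>verts K. x u * lap y u) = (\<Sum>u\<in>verts K. \<Sum>e\<in>edges K. wt K e *
     (((of_bool (u = p e) - of_bool (u = q e)) * x u) * (y (p e) - y (q e))))"
    by (simp add: lap_edge_sum sum_distrib_left algebra_simps)
  also have "\<dots> = (\<Sum>e\<in>edges K. \<Sum>u\<in>verts K. wt K e *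
     (((of_bool (u = p e) - of_bool (u = q e)) * x u) * (y (p e) - y (q e))))"
    by (rule sum.swap)
  also have "\<dots> = energy x y"
    unfolding energy_def
  proof (intro sum.cong refl)
    fix e assume e: "e \<in> edges K"
    have "(\<Sum>v\<in>verts K. (of_bool (v = p e) - of_bool (v = q e)) * x v) = x (p e) - x (q e)"
      using e finite_verts
      by (simp add: left_diff_distrib sum_subtractf sum_of_bool_mult p_in_verts q_in_verts)
    then show "(\<Sum>u\<in>verts K. wt K e *
       (((of_bool (u = p e) - of_bool (u = q e)) * x u) * (y (p e) - y (q e))))
      = wt K e * ((x (p e) - x (q e)) * (y (p e) - y (q e)))"
      by (simp flip: sum_distrib_left sum_distrib_right)
  qed
  finally show ?thesis .
qed

lemma energy_commute: "energy x y = energy y x"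
  by (simp add: energy_def mult.commute)

lemma energy_nonneg: "energy x x \<ge> 0"
  unfolding energy_def by (intro sum_nonneg) (simp add: wt_pos less_imp_le)

lemma energy_combination:
  "energy (\<lambda>v. x v + t * y v) (\<lambda>v. x v + t * y v)
     = energy x x + 2 * t * energy x y + t\<^sup>2 * energy y y"
  by (simp add: energy_def sum_distrib_left algebra_simps power2_eq_square flip: sum.distrib)

lemma energy_shift: "energy (\<lambda>v. x v - c) (\<lambda>v. y v - d) = energy x y"
  by (simp add: energy_def)

lemma energy_Cauchy_Schwarz: "(energy x y)\<^sup>2 \<le> energy x x * energy y y"
proof -
  let ?s = "\<lambda>x e. sqrt (wt K e) * (x (p e) - x (q e))"
  have eq: "energy x y = (\<Sum>e\<in>edges K. ?s x e * ?s y e)" for x y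
    unfolding energy_def
  proof (intro sum.cong refl)
    fix e assume "e \<in> edges K"
    then have "sqrt (wt K e) * sqrt (wt K e) = wt K e" using wt_pos[of e] by simp
    then show "wt K e * ((x (p e) - x (q e)) * (y (p e) - y (q e))) = ?s x e * ?s y e"
      by (metis mult.assoc mult.left_commute)
  qed
  show ?thesis
    unfolding eq using Cauchy_Schwarz_ineq_sum[of "?s x" "?s y" "edges K"]
    by (simp only: power2_eq_square)
qed

text \<open>All edge terms are nonnegative, so each of them vanishes; equality across edges then
  spreads along paths.\<close>

lemma energy_eq_0_const:
  assumes "energy x x = 0" "u \<in> verts K" "v \<in> verts K"
  shows "x u = x v"
proof -
  have "\<forall>e\<in>edges K. wt K e * ((x (p e) - x (q e)) * (x (p e) - x (q e))) = 0"
    using assms(1) finite_edges unfolding energy_def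
    by (subst (asm) sum_nonneg_eq_0_iff) (simp_all add: wt_pos less_imp_le)
  then have flat: "x (p e) = x (q e)" if "e \<in> edges K" for e
    using that wt_pos[of e] by auto
  have step: "x a = x b" if "adjacent K a b" for a b
    using that flat ends_eq unfolding adjacent_def by (metis doubleton_eq_iff)
  have "(adjacent K)\<^sup>*\<^sup>* u v"
    using connected assms(2,3) unfolding connected_graph_def by blast
  then show ?thesis
    by induction (auto dest: step)
qed

lemma laplacian_commute: "laplacian K u v = laplacian K v u"
  by (simp add: laplacian_edge_sum mult.commute)

lemma lap_const: "lap (\<lambda>_. c) u = 0"
  by (simp add: lap_edge_sum)

lemma lap_diff: "lap (\<lambda>v. x v - y v) u = lap x u - lap y u"
  by (simp add: lap_def sum_subtractf right_diff_distrib)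

lemma sum_lap_0: "(\<Sum>u\<in>verts K. lap x u) = 0"
  using sum_lap[of "\<lambda>_. 1" x] by (simp add: energy_def)

text \<open>With \<open>J\<close> the all-ones matrix and \<open>n\<close> vertices, the pseudoinverse is \<open>(L + J)\<^sup>-\<^sup>1 - J / n\<^sup>2\<close>.\<close>

lemma is_pinv_laplacian_exists:
  obtains X where "is_pinv (verts K) (laplacian K) X"
    and "\<And>u v. u \<in> verts K \<Longrightarrow> v \<in> verts K \<Longrightarrow>
      mtx_mult (verts K) (laplacian K) X u v = of_bool (u = v) - 1 / card (verts K)"
proof -
  let ?V = "verts K" and ?L = "laplacian K"
  define n :: real where "n = card ?V"
  have n: "n > 0"
    using finite_verts verts_nonempty by (simp add: n_def card_gt_0_iff)
  define M where "M = (\<lambda>u v. ?L u v + 1)"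
  have M: "(\<Sum>v\<in>?V. M u v * x v) = lap x u + sum x ?V" for u x
    by (simp add: M_def lap_def algebra_simps sum.distrib)
  \<comment> \<open>The form of \<open>L + J\<close> is the energy plus the square of the coordinate
    sum. If it vanishes, the vector is constant with sum zero, hence zero.\<close>
  have "\<exists>x. \<forall>u\<in>?V. (\<Sum>v\<in>?V. M u v * x v) = of_bool (u = w)" for w
  proof (rule positive_definite_solvable[OF finite_verts])
    fix x :: "'v \<Rightarrow> real" assume x: "\<exists>v\<in>?V. x v \<noteq> 0"
    have eq: "(\<Sum>u\<in>?V. x u * (\<Sum>v\<in>?V. M u v * x v)) = energy x x + (sum x ?V)\<^sup>2"
      by (simp add: M distrib_left sum.distrib sum_lap power2_eq_square flip: sum_distrib_right)
    have "energy x x + (sum x ?V)\<^sup>2 \<noteq> 0"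
    proof
      assume "energy x x + (sum x ?V)\<^sup>2 = 0"
      then have "energy x x = 0" and sum0: "sum x ?V = 0"
        using energy_nonneg[of x] by (auto simp: add_nonneg_eq_0_iff)
      obtain v where v: "v \<in> ?V" "x v \<noteq> 0" using x by blast
      have "sum x ?V = n * x v"
        using energy_eq_0_const[OF \<open>energy x x = 0\<close> _ v(1)] by (simp add: n_def)
      with sum0 v n show False by simp
    qed
    then show "0 < (\<Sum>u\<in>?V. x u * (\<Sum>v\<in>?V. M u v * x v))"
      unfolding eq using energy_nonneg[of x] by (simp add: order_less_le)
  qed
  then obtain Y where Y: "\<And>w u. u \<in> ?V \<Longrightarrow> lap (Y w) u + sum (Y w) ?V = of_bool (u = w)"
    unfolding M by metis
  have sumY: "sum (Y w) ?V = 1 / n" if "w \<in> ?V" for w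
  proof -
    have "(\<Sum>u\<in>?V. lap (Y w) u + sum (Y w) ?V) = (\<Sum>u\<in>?V. of_bool (u = w))"
      by (intro sum.cong refl Y)
    then have "n * sum (Y w) ?V = 1"
      using that finite_verts by (simp add: sum.distrib sum_lap_0 n_def of_bool_def)
    then show ?thesis using n by (simp add: field_simps)
  qed
  \<comment> \<open>The column \<open>Y w\<close> has sum \<open>1 / n\<close>, so this shift makes
    the column sum zero; constants lie in the kernel of \<open>L\<close>, so \<open>lap\<close> does
    not change.\<close>
  define Z where "Z = (\<lambda>w u. Y w u - 1 / n\<^sup>2)"
  have lapZ: "lap (Z w) u = of_bool (u = w) - 1 / n" if "u \<in> ?V" "w \<in> ?V" for u w
    using Y[OF that(1), of w] by (simp add: Z_def lap_diff lap_const sumY[OF that(2)])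
  have sumZ: "sum (Z w) ?V = 0" if "w \<in> ?V" for w
    using n that by (simp add: Z_def sum_subtractf sumY power2_eq_square flip: n_def)
  \<comment> \<open>\<open>Z\<close> is its own Gram matrix for the energy form, which yields its
    symmetry.\<close>
  have Z_energy: "Z w u = energy (Z w) (Z u)" if "u \<in> ?V" "w \<in> ?V" for u w
  proof -
    have "energy (Z w) (Z u) = (\<Sum>v\<in>?V. Z w v * (of_bool (v = u) - 1 / n))"
      using that(1) by (simp add: lapZ flip: sum_lap)
    also have "\<dots> = Z w u"
      using that finite_verts sumZ[OF that(2)]
      by (simp add: right_diff_distrib sum_subtractf sum_of_bool_mult flip: sum_divide_distrib)
    finally show ?thesis by simp
  qed
  then have Z_commute: "Z w u = Z u w" if "u \<in> ?V" "w \<in> ?V" for u w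
    using that by (simp add: energy_commute)
  define X where "X = (\<lambda>u v. if u \<in> ?V \<and> v \<in> ?V then Z v u else 0)"
  \<comment> \<open>Both products \<open>L X\<close> and \<open>X L\<close> are the orthogonal
    projection onto the vectors with sum zero. The Penrose conditions follow, as this projection is
    symmetric and fixes the columns of \<open>L\<close> and of \<open>X\<close>.\<close>
  have LX: "mtx_mult ?V ?L X u v = of_bool (u = v) - 1 / n" if "u \<in> ?V" "v \<in> ?V" for u v
    using that lapZ[OF that] by (simp add: mtx_mult_def X_def lap_def)
  have XL: "mtx_mult ?V X ?L u v = of_bool (u = v) - 1 / n" if "u \<in> ?V" "v \<in> ?V" for u v
  proof -
    have "mtx_mult ?V X ?L u v = (\<Sum>w\<in>?V. ?L v w * Z u w)"
      using that unfolding mtx_mult_def X_def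
      by (intro sum.cong refl) (simp add: Z_commute laplacian_commute)
    then show ?thesis using lapZ[OF that(2,1)] by (auto simp: lap_def)
  qed
  have proj: "(\<Sum>w\<in>?V. (of_bool (u = w) - 1 / n) * x w) = x u - sum x ?V / n"
    if "u \<in> ?V" for u and x :: "'v \<Rightarrow> real"
    using that finite_verts
    by (simp add: left_diff_distrib sum_subtractf sum_of_bool_mult sum_divide_distrib)
  have "mtx_eq ?V (mtx_mult ?V (mtx_mult ?V ?L X) ?L) ?L"
    unfolding mtx_eq_def
  proof (intro ballI)
    fix u v assume uv: "u \<in> ?V" "v \<in> ?V"
    have "sum (\<lambda>w. ?L w v) ?V = lap (\<lambda>_. 1) v"
      by (simp add: lap_def laplacian_commute)
    then have "sum (\<lambda>w. ?L w v) ?V = 0" by (simp add: lap_const)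
    then show "mtx_mult ?V (mtx_mult ?V ?L X) ?L u v = ?L u v"
      using uv proj[of u "\<lambda>w. ?L w v"] unfolding mtx_mult_def[of _ "mtx_mult ?V ?L X"]
      by (simp add: LX)
  qed
  moreover have "mtx_eq ?V (mtx_mult ?V (mtx_mult ?V X ?L) X) X"
    unfolding mtx_eq_def
  proof (intro ballI)
    fix u v assume uv: "u \<in> ?V" "v \<in> ?V"
    have "sum (\<lambda>w. X w v) ?V = 0" using sumZ uv by (simp add: X_def)
    then show "mtx_mult ?V (mtx_mult ?V X ?L) X u v = X u v"
      using uv proj[of u "\<lambda>w. X w v"] unfolding mtx_mult_def[of _ "mtx_mult ?V X ?L"]
      by (simp add: XL)
  qed
  ultimately have "is_pinv ?V ?L X"
    unfolding is_pinv_def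
    by (auto simp: X_def[THEN fun_cong, THEN fun_cong] mtx_eq_def mtx_transpose_def LX XL)
  then show ?thesis using LX that by (simp add: n_def)
qed

text \<open>The projection \<open>L X\<close> fixes \<open>b\<close>, so \<open>x = X b\<close>
  solves the Poisson equation with right-hand side \<open>b\<close>; the quadratic form is then
  \<open>b\<close> paired with \<open>x\<close>, that is, \<open>lap x\<close> paired with
  \<open>x\<close>.\<close>

lemma pinv_quadratic_form:
  assumes "sum b (verts K) = 0"
  obtains x where "\<And>u. u \<in> verts K \<Longrightarrow> lap x u = b u"
    and "(\<Sum>s\<in>verts K. \<Sum>t\<in>verts K. b s * pinv (verts K) (laplacian K) s t * b t) = energy x x"
proof -
  let ?V = "verts K"
  obtain X where X: "is_pinv ?V (laplacian K) X"
    and LX: "\<And>u v. u \<in> ?V \<Longrightarrow> v \<in> ?V \<Longrightarrow>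
      mtx_mult ?V (laplacian K) X u v = of_bool (u = v) - 1 / card ?V"
    using is_pinv_laplacian_exists by blast
  define x where "x = (\<lambda>s. \<Sum>t\<in>?V. X s t * b t)"
  have lap: "lap x u = b u" if u: "u \<in> ?V" for u
  proof -
    have "lap x u = (\<Sum>v\<in>?V. \<Sum>t\<in>?V. laplacian K u v * X v t * b t)"
      by (simp add: lap_def x_def sum_distrib_left mult.assoc)
    also have "\<dots> = (\<Sum>t\<in>?V. mtx_mult ?V (laplacian K) X u t * b t)"
      unfolding mtx_mult_def sum_distrib_right by (rule sum.swap)
    also have "\<dots> = (\<Sum>t\<in>?V. of_bool (u = t) * b t - b t / card ?V)"
      using u by (intro sum.cong refl) (simp add: LX left_diff_distrib)
    also have "\<dots> = b u"
      using u finite_verts assms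
      by (simp add: sum_subtractf sum_of_bool_mult flip: sum_divide_distrib)
    finally show ?thesis .
  qed
  have "(\<Sum>s\<in>?V. \<Sum>t\<in>?V. b s * pinv ?V (laplacian K) s t * b t) = (\<Sum>s\<in>?V. b s * x s)"
    by (simp add: pinv_eqI[OF X] x_def sum_distrib_left mult.assoc)
  also have "\<dots> = (\<Sum>s\<in>?V. x s * lap x s)"
    by (intro sum.cong refl) (simp add: lap)
  also have "\<dots> = energy x x" by (rule sum_lap)
  finally show ?thesis using lap that by blast
qed

section \<open>Degree-weighted norm, truncations and medians\<close>

definition sqnorm :: "('v \<Rightarrow> real) \<Rightarrow> real" where
  "sqnorm x = (\<Sum>v\<in>verts K. wdegree K v * (x v)\<^sup>2)"

lemma wdegree_nonneg: "wdegree K v \<ge> 0"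
  unfolding wdegree_def by (intro sum_nonneg) (auto dest: wt_pos intro: less_imp_le)

lemma vol_mono: "A \<subseteq> B \<Longrightarrow> B \<subseteq> verts K \<Longrightarrow> vol K A \<le> vol K B"
  unfolding vol_def
  by (intro sum_mono2 wdegree_nonneg) (auto intro: finite_subset[OF _ finite_verts])

lemma vol_nonneg: "vol K A \<ge> 0"
  unfolding vol_def by (intro sum_nonneg wdegree_nonneg)

lemma vol_Diff: "A \<subseteq> verts K \<Longrightarrow> vol K (verts K - A) = vol K (verts K) - vol K A"
  unfolding vol_def by (intro sum_diff finite_verts)

lemma sqnorm_nonneg: "sqnorm x \<ge> 0"
  unfolding sqnorm_def by (intro sum_nonneg mult_nonneg_nonneg wdegree_nonneg) simp

lemma sqnorm_combination:
  "sqnorm (\<lambda>v. x v + t * y v) = sqnorm x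
     + 2 * t * (\<Sum>v\<in>verts K. wdegree K v * (x v * y v)) + t\<^sup>2 * sqnorm y"
  by (simp add: sqnorm_def sum_distrib_left algebra_simps power2_eq_square flip: sum.distrib)

text \<open>The cross term vanishes for weighted mean zero. Hence moving the origin, later to a
  median, never decreases the norm.\<close>

lemma sqnorm_shift:
  assumes "(\<Sum>v\<in>verts K. wdegree K v * x v) = 0"
  shows "sqnorm (\<lambda>v. x v - c) = sqnorm x + c\<^sup>2 * vol K (verts K)"
proof -
  have "sqnorm (\<lambda>v. x v - c) = sqnorm x - 2 * c * (\<Sum>v\<in>verts K. wdegree K v * x v)
      + c\<^sup>2 * vol K (verts K)"
    by (simp add: sqnorm_def vol_def sum_distrib_left algebra_simps power2_eq_square
        flip: sum.distrib sum_subtractf)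
  with assms show ?thesis by simp
qed

text \<open>The hypothesis is applied to each edge separately. It serves both the positive and
  negative parts and the dyadic slices.\<close>

lemma energy_truncations_le:
  assumes "\<And>x y :: real. (\<Sum>i\<in>I. (\<phi> i x - \<phi> i y)\<^sup>2) \<le> (x - y)\<^sup>2"
  shows "(\<Sum>i\<in>I. energy (\<lambda>v. \<phi> i (h v)) (\<lambda>v. \<phi> i (h v))) \<le> energy h h"
proof -
  have "(\<Sum>i\<in>I. energy (\<lambda>v. \<phi> i (h v)) (\<lambda>v. \<phi> i (h v)))
      = (\<Sum>e\<in>edges K. wt K e * (\<Sum>i\<in>I. (\<phi> i (h (p e)) - \<phi> i (h (q e)))\<^sup>2))"
    unfolding energy_def sum_distrib_left power2_eq_square by (rule sum.swap)
  also have "\<dots> \<le> energy h h"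
    unfolding energy_def
    by (intro sum_mono mult_left_mono)
      (use assms in \<open>auto simp: power2_eq_square dest: wt_pos intro: less_imp_le\<close>)
  finally show ?thesis .
qed

text \<open>The median is the smallest value of \<open>f\<close> whose sublevel set carries at least
  half of the volume.\<close>

lemma median_exists:
  fixes f :: "'v \<Rightarrow> real"
  obtains m where "vol K {v \<in> verts K. f v < m} \<le> vol K (verts K) / 2"
    and "vol K {v \<in> verts K. f v > m} \<le> vol K (verts K) / 2"
proof -
  let ?V = "verts K"
  define A where "A = {t \<in> f ` ?V. vol K {v \<in> ?V. f v \<le> t} \<ge> vol K ?V / 2}"
  have finA: "finite A" using finite_verts by (simp add: A_def)
  have "{v \<in> ?V. f v \<le> Max (f ` ?V)} = ?V" using finite_verts by auto
  then have "Max (f ` ?V) \<in> A"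
    using finite_verts verts_nonempty vol_nonneg[of ?V] by (simp add: A_def)
  then have "A \<noteq> {}" by blast
  define m where "m = Min A"
  have "m \<in> A" using finA \<open>A \<noteq> {}\<close> by (simp add: m_def)
  have "{v \<in> ?V. f v > m} = ?V - {v \<in> ?V. f v \<le> m}" by auto
  then have "vol K {v \<in> ?V. f v > m} = vol K ?V - vol K {v \<in> ?V. f v \<le> m}"
    by (simp add: vol_Diff)
  with \<open>m \<in> A\<close> have 1: "vol K {v \<in> ?V. f v > m} \<le> vol K ?V / 2"
    by (simp add: A_def)
  have 2: "vol K {v \<in> ?V. f v < m} \<le> vol K ?V / 2"
  proof (cases "{v \<in> ?V. f v < m} = {}")
    case True
    show ?thesis unfolding True using vol_nonneg[of ?V] by (simp add: vol_def)
  next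
    case False
    \<comment> \<open>The largest value below \<open>m\<close>: its sublevel set is exactly
      \<open>{f < m}\<close>, and minimality of \<open>m\<close> keeps \<open>t\<close> out of
      \<open>A\<close>.\<close>
    define t where "t = Max (f ` {v \<in> ?V. f v < m})"
    have t: "t \<in> f ` {v \<in> ?V. f v < m}"
      unfolding t_def using False finite_verts by (intro Max_in) auto
    then have "t \<notin> A" using Min_le[OF finA, of t] by (auto simp: m_def)
    moreover have "f v \<le> t" if "v \<in> ?V" "f v < m" for v
      unfolding t_def using that finite_verts by (intro Max_ge) auto
    then have "{v \<in> ?V. f v \<le> t} = {v \<in> ?V. f v < m}"
      using t by force
    ultimately show ?thesis using t by (auto simp: A_def)
  qed
  show ?thesis using that 1 2 by blast
qed

end

text \<open>The first-order condition at a minimum: a nonzero slope at \<open>t = 0\<close> would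
  make the quadratic negative nearby.\<close>

lemma linear_coeff_zeroI:
  fixes a b :: real
  assumes "\<And>t. 2 * t * a + t\<^sup>2 * b \<ge> 0"
  shows "a = 0"
proof (rule ccontr)
  assume "a \<noteq> 0"
  \<comment> \<open>The vertex of the parabola whose leading coefficient \<open>b\<close> is
    enlarged to the positive number \<open>\<bar>b\<bar> + 1\<close>.\<close>
  define t where "t = - a / (\<bar>b\<bar> + 1)"
  have "2 * t * a + t\<^sup>2 * b \<le> 2 * t * a + t\<^sup>2 * (\<bar>b\<bar> + 1)"
    by (intro add_left_mono mult_left_mono) auto
  also have "\<dots> = - (a\<^sup>2 / (\<bar>b\<bar> + 1))"
  proof -
    have "t * (\<bar>b\<bar> + 1) = - a" by (simp add: t_def)
    then have "t\<^sup>2 * (\<bar>b\<bar> + 1) = - (t * a)" by (simp add: power2_eq_square mult.assoc)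
    moreover have "t * a = - (a\<^sup>2 / (\<bar>b\<bar> + 1))" by (simp add: t_def power2_eq_square)
    ultimately show ?thesis by simp
  qed
  also have "\<dots> < 0" using \<open>a \<noteq> 0\<close> by simp
  finally show False using assms[of t] by simp
qed

section \<open>Variational characterization of the spectral gap\<close>

locale nontrivial_graph = oriented_graph K p q
  for K :: "('v, 'e) wgraph" and p q :: "'e \<Rightarrow> 'v" +
  assumes two_verts: "card (verts K) \<ge> 2"
begin

text \<open>A path from \<open>v\<close> to some other vertex begins with an edge at
  \<open>v\<close>.\<close>

lemma wdegree_pos:
  assumes "v \<in> verts K"
  shows "wdegree K v > 0"
proof -
  obtain w where w: "w \<in> verts K" "w \<noteq> v"
    using two_verts assms
    by (metis card_2_iff' card_le_Suc0_iff_eq finite_verts not_less_eq_eq numeral_2_eq_2)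
  have "(adjacent K)\<^sup>*\<^sup>* v w"
    using connected assms w(1) unfolding connected_graph_def by blast
  then obtain y where "adjacent K v y"
    using w(2) by (metis converse_rtranclpE)
  then obtain e where "e \<in> edges K" "v \<in> ends K e"
    unfolding adjacent_def by auto
  then show ?thesis
    unfolding wdegree_def using finite_edges by (intro sum_pos) (auto dest: wt_pos)
qed

lemma vol_pos:
  assumes "A \<subseteq> verts K" "A \<noteq> {}"
  shows "vol K A > 0"
  unfolding vol_def using assms
  by (intro sum_pos) (auto intro: wdegree_pos finite_subset[OF _ finite_verts])

lemma sqnorm_pos:
  assumes "v \<in> verts K" "x v \<noteq> 0"
  shows "sqnorm x > 0"
  unfolding sqnorm_def using assms
  by (intro sum_pos2[OF finite_verts])
    (auto intro!: mult_pos_pos mult_nonneg_nonneg wdegree_pos wdegree_nonneg)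

lemma normalized_laplacian_entry:
  assumes "u \<in> verts K" "v \<in> verts K"
  shows "normalized_laplacian K u v = laplacian K u v / (sqrt (wdegree K u) * sqrt (wdegree K v))"
proof -
  have "mtx_mult (verts K) (degree_inv_sqrt_mtx K) (laplacian K) u w
      = laplacian K u w / sqrt (wdegree K u)" for w
    using assms finite_verts
    by (simp add: mtx_mult_def degree_inv_sqrt_mtx_def diag_mtx_def if_distrib if_distribR
        cong: if_cong)
  then show ?thesis
    using assms finite_verts unfolding normalized_laplacian_def mtx_mult_def[of _ "mtx_mult _ _ _"]
    by (simp add: degree_inv_sqrt_mtx_def diag_mtx_def if_distrib if_distribR cong: if_cong)
qed

text \<open>The substitution of \<open>D^(1/2) y\<close> for the eigenvector turns the eigenvalue
  equation of the normalized Laplacian into \<open>L y = \<mu> D y\<close>, free of square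
  roots.\<close>

lemma eigenvalue_normalized_laplacian_iff:
  "mtx_eigenvalue (verts K) (normalized_laplacian K) \<mu> \<longleftrightarrow>
     (\<exists>y. (\<exists>v\<in>verts K. y v \<noteq> 0) \<and> (\<forall>u\<in>verts K. lap y u = \<mu> * (wdegree K u * y u)))"
proof -
  let ?s = "\<lambda>v. sqrt (wdegree K v)"
  have s: "?s u \<noteq> 0" "?s u * ?s u = wdegree K u" if "u \<in> verts K" for u
    using wdegree_pos[OF that] by simp_all
  have N: "(\<Sum>v\<in>verts K. normalized_laplacian K u v * (?s v * y v)) = lap y u / ?s u"
    if "u \<in> verts K" for u y
    unfolding lap_def sum_divide_distrib
    using that s by (intro sum.cong refl) (simp add: normalized_laplacian_entry)
  have iff: "(\<Sum>v\<in>verts K. normalized_laplacian K u v * (?s v * y v)) = \<mu> * (?s u * y u)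
      \<longleftrightarrow> lap y u = \<mu> * (wdegree K u * y u)" if "u \<in> verts K" for u y
    unfolding N[OF that] using s[OF that] by (simp add: divide_eq_eq algebra_simps)
  show ?thesis
  proof
    assume "mtx_eigenvalue (verts K) (normalized_laplacian K) \<mu>"
    then obtain x where x: "\<exists>v\<in>verts K. x v \<noteq> 0"
      "\<And>u. u \<in> verts K \<Longrightarrow> (\<Sum>v\<in>verts K. normalized_laplacian K u v * x v) = \<mu> * x u"
      unfolding mtx_eigenvalue_def by blast
    have "(\<Sum>v\<in>verts K. normalized_laplacian K u v * (?s v * (x v / ?s v))) = \<mu> * (?s u * (x u / ?s u))"
      if "u \<in> verts K" for u
      using that s x(2)[OF that] by simp
    then have "\<forall>u\<in>verts K. lap (\<lambda>v. x v / ?s v) u = \<mu> * (wdegree K u * (x u / ?s u))"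
      using iff[of _ "\<lambda>v. x v / ?s v"] by blast
    then show "\<exists>y. (\<exists>v\<in>verts K. y v \<noteq> 0) \<and> (\<forall>u\<in>verts K. lap y u = \<mu> * (wdegree K u * y u))"
      using x(1) s by (intro exI[of _ "\<lambda>v. x v / ?s v"]) auto
  next
    assume "\<exists>y. (\<exists>v\<in>verts K. y v \<noteq> 0) \<and> (\<forall>u\<in>verts K. lap y u = \<mu> * (wdegree K u * y u))"
    then obtain y where y: "\<exists>v\<in>verts K. y v \<noteq> 0"
      "\<And>u. u \<in> verts K \<Longrightarrow> lap y u = \<mu> * (wdegree K u * y u)" by blast
    then show "mtx_eigenvalue (verts K) (normalized_laplacian K) \<mu>"
      unfolding mtx_eigenvalue_def using s iff
      by (intro exI[of _ "\<lambda>v. ?s v * y v"]) auto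
  qed
qed

text \<open>The continuous energy attains its minimum on the compact unit sphere of the
  weighted-mean-zero functions; the bound for other functions follows by scaling.\<close>

lemma Rayleigh_minimizer_exists:
  obtains f where "(\<Sum>v\<in>verts K. wdegree K v * f v) = 0" "sqnorm f = 1"
    and "\<And>x. (\<Sum>v\<in>verts K. wdegree K v * x v) = 0 \<Longrightarrow> energy f f * sqnorm x \<le> energy x x"
proof -
  let ?V = "verts K" and ?d = "wdegree K"
  \<comment> \<open>A unit function satisfies \<open>?d v * (y v)^2 \<le> 1\<close>, which gives the
    box. Coordinates outside the vertex set are pinned to 0, so that Tychonoff's theorem yields
    compactness in the full function space.\<close>
  define C where "C = (\<lambda>v. if v \<in> ?V then {- (1 / sqrt (?d v)) .. 1 / sqrt (?d v)} else {0})"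
  define S where "S = (Pi UNIV C \<inter> {x. (\<Sum>v\<in>?V. ?d v * x v) = 0}) \<inter> {x. sqnorm x = 1}"
  have cont: "continuous_on UNIV (\<lambda>x :: 'v \<Rightarrow> real. x v)" for v
    by (rule continuous_on_product_coordinates)
  have "compactin (product_topology (\<lambda>_. euclidean) UNIV) (PiE UNIV C)"
    unfolding compactin_PiE by (auto simp: C_def)
  then have "compact (Pi UNIV C)"
    by (simp add: PiE_UNIV_domain euclidean_product_topology)
  moreover have "closed {x. (\<Sum>v\<in>?V. ?d v * x v) = 0}"
    by (intro closed_Collect_eq continuous_intros cont)
  moreover have "closed {x. sqnorm x = 1}"
    unfolding sqnorm_def by (intro closed_Collect_eq continuous_intros cont)
  ultimately have compact: "compact S"
    unfolding S_def by (intro compact_Int_closed)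
  have unit: "\<exists>y\<in>S. energy y y = energy x x / sqnorm x"
    if orth: "(\<Sum>v\<in>?V. ?d v * x v) = 0" and pos: "sqnorm x > 0" for x
  proof
    define c where "c = 1 / sqrt (sqnorm x)"
    define y where "y = (\<lambda>v. if v \<in> ?V then c * x v else 0)"
    have c2: "c\<^sup>2 = 1 / sqnorm x" using pos by (simp add: c_def power_divide)
    show "energy y y = energy x x / sqnorm x"
    proof -
      have "energy y y = (\<Sum>e\<in>edges K. c\<^sup>2 * (wt K e * ((x (p e) - x (q e)) * (x (p e) - x (q e)))))"
        unfolding energy_def
        by (intro sum.cong refl) (simp add: y_def p_in_verts q_in_verts power2_eq_square algebra_simps)
      also have "\<dots> = c\<^sup>2 * energy x x" by (simp add: energy_def sum_distrib_left)
      finally show ?thesis by (simp add: c2)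
    qed
    have y_orth: "(\<Sum>v\<in>?V. ?d v * y v) = 0"
      using orth by (simp add: y_def mult.left_commute flip: sum_distrib_left)
    have "sqnorm y = c\<^sup>2 * sqnorm x"
      by (simp add: sqnorm_def y_def power_mult_distrib sum_distrib_left mult.left_commute)
    then have y_unit: "sqnorm y = 1" using pos by (simp add: c2)
    have "y v \<in> C v" for v
    proof (cases "v \<in> ?V")
      case True
      have "?d v * (y v)\<^sup>2 \<le> sqnorm y"
        unfolding sqnorm_def using True finite_verts
        by (intro member_le_sum) (auto intro!: mult_nonneg_nonneg wdegree_nonneg)
      then have "(y v)\<^sup>2 \<le> (1 / sqrt (?d v))\<^sup>2"
        using wdegree_pos[OF True] y_unit by (simp add: field_simps power_divide)
      then have "\<bar>y v\<bar> \<le> 1 / sqrt (?d v)"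
        using wdegree_pos[OF True] by (simp add: abs_le_square_iff[symmetric])
      then show ?thesis using True by (auto simp: C_def abs_le_iff)
    qed (simp add: C_def y_def)
    then show "y \<in> S" using y_orth y_unit by (simp add: S_def)
  qed
  obtain a b where ab: "a \<in> ?V" "b \<in> ?V" "a \<noteq> b"
    using two_verts
    by (metis card_2_iff' card_le_Suc0_iff_eq finite_verts not_less_eq_eq numeral_2_eq_2)
  \<comment> \<open>A nonzero function of weighted mean zero, made from two distinct vertices;
    scaled to norm 1 it shows that \<open>S\<close> is nonempty.\<close>
  define z where "z = (\<lambda>v. of_bool (v = a) / ?d a - of_bool (v = b) / ?d b)"
  have "(\<Sum>v\<in>?V. ?d v * z v) = (\<Sum>v\<in>?V. of_bool (v = a) * (?d v / ?d a))
      - (\<Sum>v\<in>?V. of_bool (v = b) * (?d v / ?d b))"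
    by (simp add: z_def algebra_simps flip: sum_subtractf)
  also have "\<dots> = 0"
    using ab finite_verts wdegree_pos[OF ab(1)] wdegree_pos[OF ab(2)]
    by (simp add: sum_of_bool_mult del: times_divide_eq_right)
  finally have "(\<Sum>v\<in>?V. ?d v * z v) = 0" .
  moreover have "z a \<noteq> 0" using ab wdegree_pos[OF ab(1)] by (simp add: z_def)
  ultimately have "S \<noteq> {}" using unit[of z] sqnorm_pos[OF ab(1)] by blast
  moreover have "continuous_on S (\<lambda>x. energy x x)"
    unfolding energy_def by (intro continuous_intros continuous_on_subset[OF cont]) auto
  ultimately obtain f where f: "f \<in> S" "\<And>y. y \<in> S \<Longrightarrow> energy f f \<le> energy y y"
    using continuous_attains_inf[OF compact] by blast
  have "energy f f * sqnorm x \<le> energy x x" if "(\<Sum>v\<in>?V. ?d v * x v) = 0" for x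
  proof (cases "sqnorm x = 0")
    case True
    then show ?thesis by (simp add: energy_nonneg)
  next
    case False
    then have "sqnorm x > 0" using sqnorm_nonneg[of x] by simp
    with unit[OF that] f(2) have "energy f f \<le> energy x x / sqnorm x" by force
    then show ?thesis using \<open>sqnorm x > 0\<close> by (simp add: field_simps)
  qed
  then show ?thesis using f(1) by (intro that[of f]) (auto simp: S_def)
qed

text \<open>The Rayleigh minimum is positive by connectedness, and stationarity makes the minimizer
  an eigenfunction. Eigenfunctions of nonzero eigenvalues have weighted mean zero, so no such
  eigenvalue is smaller.\<close>

lemma spectral_gap_variational:
  obtains f where "(\<Sum>v\<in>verts K. wdegree K v * f v) = 0" "sqnorm f = 1"
    and "energy f f = spectral_gap K" "spectral_gap K > 0"
    and "\<And>x. (\<Sum>v\<in>verts K. wdegree K v * x v) = 0 \<Longrightarrow>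
      spectral_gap K * sqnorm x \<le> energy x x"
proof -
  let ?V = "verts K" and ?d = "wdegree K"
  obtain f where f: "(\<Sum>v\<in>?V. ?d v * f v) = 0" "sqnorm f = 1"
    and min: "\<And>x. (\<Sum>v\<in>?V. ?d v * x v) = 0 \<Longrightarrow> energy f f * sqnorm x \<le> energy x x"
    using Rayleigh_minimizer_exists by blast
  define \<mu> where "\<mu> = energy f f"
  have "\<mu> \<noteq> 0"
  proof
    assume "\<mu> = 0"
    then have const: "f u = f v" if "u \<in> ?V" "v \<in> ?V" for u v
      using energy_eq_0_const that by (simp add: \<mu>_def)
    obtain w where w: "w \<in> ?V" using verts_nonempty by blast
    have "(\<Sum>v\<in>?V. ?d v * f v) = vol K ?V * f w"
      unfolding vol_def sum_distrib_right by (intro sum.cong refl) (metis const w)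
    with f(1) vol_pos[of ?V] verts_nonempty have "f w = 0" by auto
    then have "sqnorm f = 0" using const[OF _ w] by (simp add: sqnorm_def)
    with f(2) show False by simp
  qed
  then have pos: "\<mu> > 0" using energy_nonneg[of f] by (simp add: \<mu>_def)
  have stationary: "energy f y = \<mu> * (\<Sum>v\<in>?V. ?d v * (f v * y v))"
    if y: "(\<Sum>v\<in>?V. ?d v * y v) = 0" for y
  proof -
    have "2 * t * (energy f y - \<mu> * (\<Sum>v\<in>?V. ?d v * (f v * y v)))
        + t\<^sup>2 * (energy y y - \<mu> * sqnorm y) \<ge> 0" for t
    proof -
      have "(\<Sum>v\<in>?V. ?d v * (f v + t * y v))
          = (\<Sum>v\<in>?V. ?d v * f v) + t * (\<Sum>v\<in>?V. ?d v * y v)"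
        by (simp add: sum_distrib_left algebra_simps flip: sum.distrib)
      then have "\<mu> * sqnorm (\<lambda>v. f v + t * y v) \<le> energy (\<lambda>v. f v + t * y v) (\<lambda>v. f v + t * y v)"
        using min f y by (simp add: \<mu>_def)
      then show ?thesis
        unfolding energy_combination sqnorm_combination f(2) \<mu>_def by (simp add: algebra_simps)
    qed
    from linear_coeff_zeroI[OF this] show ?thesis by simp
  qed
  have lap_f: "lap f u = \<mu> * (?d u * f u)" if u: "u \<in> ?V" for u
  proof -
    define c where "c = ?d u / vol K ?V"
    \<comment> \<open>The indicator of \<open>u\<close>, shifted to weighted mean zero. Stationarity
      in this direction is the eigenvalue equation at \<open>u\<close>: the shift contributes
      nothing, since both \<open>?d v * f v\<close> and \<open>lap f v\<close> sum to zero.\<close>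
    define y where "y = (\<lambda>v. of_bool (v = u) - c)"
    have V: "vol K ?V > 0" using vol_pos verts_nonempty by blast
    have "(\<Sum>v\<in>?V. ?d v * y v) = ?d u - vol K ?V * c"
      using u finite_verts
      by (simp add: y_def right_diff_distrib sum_subtractf sum_of_bool_mult vol_def sum_distrib_right)
    also have "\<dots> = 0" using V by (simp add: c_def)
    finally have "energy f y = \<mu> * (\<Sum>v\<in>?V. ?d v * (f v * y v))" by (rule stationary)
    also have "(\<Sum>v\<in>?V. ?d v * (f v * y v))
        = (\<Sum>v\<in>?V. (?d v * f v) * of_bool (v = u)) - c * (\<Sum>v\<in>?V. ?d v * f v)"
      by (simp add: y_def sum_distrib_left algebra_simps flip: sum_subtractf)
    also have "\<dots> = ?d u * f u" using u finite_verts f(1) by (simp add: sum_of_bool_mult)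
    finally have "energy f y = \<mu> * (?d u * f u)" .
    moreover have "energy f y = (\<Sum>v\<in>?V. y v * lap f v)"
      by (metis energy_commute sum_lap)
    then have "energy f y = (\<Sum>v\<in>?V. of_bool (v = u) * lap f v) - c * (\<Sum>v\<in>?V. lap f v)"
      by (simp add: y_def sum_distrib_left algebra_simps flip: sum_subtractf)
    ultimately show ?thesis using u finite_verts by (simp add: sum_of_bool_mult sum_lap_0)
  qed
  have "spectral_gap K = \<mu>"
    unfolding spectral_gap_def
  proof (rule Least_equality)
    have "\<exists>v\<in>?V. f v \<noteq> 0" using f(2) by (auto simp: sqnorm_def intro: ccontr)
    then show "mtx_eigenvalue ?V (normalized_laplacian K) \<mu> \<and> \<mu> \<noteq> 0"
      unfolding eigenvalue_normalized_laplacian_iff using lap_f \<open>\<mu> \<noteq> 0\<close> by blast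
  next
    fix \<nu> assume "mtx_eigenvalue ?V (normalized_laplacian K) \<nu> \<and> \<nu> \<noteq> 0"
    then obtain y v where v: "v \<in> ?V" "y v \<noteq> 0" and "\<nu> \<noteq> 0"
      and lap_y: "\<And>u. u \<in> ?V \<Longrightarrow> lap y u = \<nu> * (?d u * y u)"
      unfolding eigenvalue_normalized_laplacian_iff by blast
    have "0 = (\<Sum>u\<in>?V. lap y u)" by (simp add: sum_lap_0)
    also have "\<dots> = \<nu> * (\<Sum>u\<in>?V. ?d u * y u)" by (simp add: lap_y sum_distrib_left)
    finally have "(\<Sum>u\<in>?V. ?d u * y u) = 0" using \<open>\<nu> \<noteq> 0\<close> by simp
    from min[OF this] have "\<mu> * sqnorm y \<le> (\<Sum>u\<in>?V. y u * lap y u)"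
      by (simp add: \<mu>_def sum_lap)
    also have "\<dots> = \<nu> * sqnorm y"
      by (simp add: lap_y sqnorm_def sum_distrib_left power2_eq_square mult_ac)
    finally show "\<mu> \<le> \<nu>" using sqnorm_pos[of v y] v by simp
  qed
  with f min pos that show ?thesis by (simp add: \<mu>_def)
qed

lemma spectral_gap_pos: "spectral_gap K > 0"
  using spectral_gap_variational by blast

lemma spectral_gap_le:
  assumes "(\<Sum>v\<in>verts K. wdegree K v * x v) = 0"
  shows "spectral_gap K * sqnorm x \<le> energy x x"
  using spectral_gap_variational assms by blast

end

section \<open>Dyadic slicing and the choice of a level cut\<close>

text \<open>The least \<open>k\<close> with \<open>x < 2 ^ k * \<epsilon>\<close> is at least 2,
  because \<open>2 * \<epsilon> \<le> x\<close>; hence \<open>k = i + 2\<close>.\<close>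

lemma dyadic_scale:
  fixes x \<epsilon> :: real
  assumes "\<epsilon> > 0" "2 * \<epsilon> \<le> x"
  obtains i :: nat where "2 ^ Suc i * \<epsilon> \<le> x" "x < 2 ^ Suc (Suc i) * \<epsilon>"
proof -
  obtain n where "x / \<epsilon> < 2 ^ n" using real_arch_pow[of 2 "x / \<epsilon>"] by auto
  then have ex: "x < 2 ^ n * \<epsilon>" using assms by (simp add: field_simps)
  define k where "k = (LEAST n. x < 2 ^ n * \<epsilon>)"
  have k: "x < 2 ^ k * \<epsilon>" unfolding k_def using ex by (rule LeastI)
  have "k \<noteq> 0" "k \<noteq> 1" using k assms by (auto intro: ccontr)
  then obtain i where i: "k = Suc (Suc i)" by (metis One_nat_def not0_implies_Suc)
  then have "\<not> x < 2 ^ Suc i * \<epsilon>" unfolding k_def[symmetric]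
    using not_less_Least[of "Suc i" "\<lambda>n. x < 2 ^ n * \<epsilon>"] by (simp add: k_def)
  with k i show ?thesis by (intro that[of i]) simp_all
qed

lemma sum_squares_le_square_sum:
  fixes a :: "nat \<Rightarrow> real"
  assumes "\<And>i. a i \<ge> 0"
  shows "(\<Sum>i<n. (a i)\<^sup>2) \<le> (\<Sum>i<n. a i)\<^sup>2"
proof (induction n)
  case (Suc n)
  have "(\<Sum>i<n. a i) * a n \<ge> 0" using assms by (intro mult_nonneg_nonneg sum_nonneg) auto
  with Suc show ?case by (simp add: power2_sum)
qed simp

text \<open>Each slice is a nondecreasing function, so for \<open>y \<le> x\<close> its increments
  are nonnegative. They telescope to at most \<open>x - y\<close>, and a sum of squares of
  nonnegative numbers is at most the square of their sum.\<close>

lemma sum_slices_contraction: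
  fixes t :: "nat \<Rightarrow> real" and x y :: real
  assumes "mono t"
  shows "(\<Sum>i<n. ((min x (t (Suc i)) - min x (t i)) - (min y (t (Suc i)) - min y (t i)))\<^sup>2)
    \<le> (x - y)\<^sup>2"
proof -
  have *: "(\<Sum>i<n. ((min x (t (Suc i)) - min x (t i)) - (min y (t (Suc i)) - min y (t i)))\<^sup>2)
    \<le> (x - y)\<^sup>2" if "y \<le> x" for x y
  proof -
    let ?a = "\<lambda>i. (min x (t (Suc i)) - min x (t i)) - (min y (t (Suc i)) - min y (t i))"
    have nonneg: "?a i \<ge> 0" for i
      using that monoD[OF assms, of i "Suc i"] by (auto simp: min_def)
    have "(\<Sum>i<n. ?a i) = (min x (t n) - min x (t 0)) - (min y (t n) - min y (t 0))"
      unfolding sum_subtractf[of "\<lambda>i. min x (t (Suc i)) - min x (t i)"]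
      using sum_lessThan_telescope[of "\<lambda>i. min x (t i)" n]
        sum_lessThan_telescope[of "\<lambda>i. min y (t i)" n] by simp
    also have "\<dots> \<le> x - y"
      using that by (auto simp: min_def)
    finally have "(\<Sum>i<n. ?a i)\<^sup>2 \<le> (x - y)\<^sup>2"
      using nonneg by (intro power_mono sum_nonneg) auto
    then show ?thesis
      using sum_squares_le_square_sum[of ?a n] nonneg by (meson order_trans)
  qed
  show ?thesis
  proof (cases "y \<le> x")
    case False
    then show ?thesis using *[of x y] by (simp add: power2_commute)
  qed (rule *)
qed

context nontrivial_graph
begin

text \<open>Pigeonhole over the dyadic slices: the total energy of the slices is at most the total
  of the bounds, so one slice obeys its own bound.\<close>

lemma level_cut_exists:
  assumes nonneg: "\<And>v. h v \<ge> 0"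
    and nonzero: "\<exists>v\<in>verts K. h v \<noteq> 0"
    and half: "vol K {v \<in> verts K. h v > 0} \<le> vol K (verts K) / 2"
    and energy: "energy h h \<le> \<mu> * sqnorm h" and "\<mu> > 0"
  obtains S1 S2 g \<alpha> where "S1 \<subseteq> verts K" "S2 \<subseteq> verts K" "S1 \<noteq> {}" "S2 \<noteq> {}" "S1 \<inter> S2 = {}"
    and "\<alpha> > 0" "\<And>v. v \<in> S1 \<Longrightarrow> g v = \<alpha>" "\<And>v. v \<in> S2 \<Longrightarrow> g v = 0"
    and "energy g g \<le> 16 * \<mu> * \<alpha>\<^sup>2 * min (vol K S1) (vol K S2)"
proof -
  let ?V = "verts K" and ?d = "wdegree K"
  define P where "P = h ` {v \<in> ?V. h v > 0}"
  have P: "finite P" "P \<noteq> {}"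
    using finite_verts nonzero nonneg by (auto simp: P_def order_less_le)
  \<comment> \<open>With half the least positive value of \<open>h\<close> as base, every positive
    value is at least \<open>t 1\<close>, so slices indexed from 0 suffice.\<close>
  define \<epsilon> where "\<epsilon> = Min P / 2"
  have "Min P > 0" using P by (subst Min_gr_iff) (auto simp: P_def)
  then have eps: "\<epsilon> > 0" by (simp add: \<epsilon>_def)
  have P_ge: "2 * \<epsilon> \<le> t" if "t \<in> P" for t using P that by (simp add: \<epsilon>_def)
  \<comment> \<open>\<open>n\<close> is the last index with \<open>A n\<close> nonempty, so every
    slice considered yields a nonempty \<open>A i\<close>.\<close>
  obtain n where n: "2 ^ Suc n * \<epsilon> \<le> Max P" "Max P < 2 ^ Suc (Suc n) * \<epsilon>"
    using dyadic_scale[OF eps P_ge[OF Max_in[OF P]]] by blast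
  define t where "t = (\<lambda>i. 2 ^ i * \<epsilon>)"
  have "mono t" using eps by (intro monoI) (simp add: t_def power_increasing)
  have t: "t i > 0" "t (Suc i) = 2 * t i" for i using eps by (simp_all add: t_def)
  define g where "g = (\<lambda>i v. min (h v) (t (Suc i)) - min (h v) (t i))"
  define A where "A = (\<lambda>i. {v \<in> ?V. h v \<ge> t (Suc i)})"
  define B where "B = (\<lambda>i. {v \<in> ?V. h v \<le> t i})"
  have slices: "(\<Sum>i<Suc n. energy (g i) (g i)) \<le> energy h h"
    unfolding g_def
    using energy_truncations_le[where I = "{..<Suc n}" and h = h
          and \<phi> = "\<lambda>i x. min x (t (Suc i)) - min x (t i)"]
      sum_slices_contraction[OF \<open>mono t\<close>, of _ _ "Suc n"] by simp
  \<comment> \<open>One layer suffices: if \<open>t (i + 1) \<le> h v < t (i + 2) = 4 * t i\<close>,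
    then the term of index \<open>i\<close> already dominates. This is the source of the constant
    16.\<close>
  have layers: "(h v)\<^sup>2 \<le> (\<Sum>i<Suc n. of_bool (v \<in> A i) * (16 * (t i)\<^sup>2))" if v: "v \<in> ?V" for v
  proof (cases "h v = 0")
    case True
    then show ?thesis by (simp add: sum_nonneg del: sum.lessThan_Suc)
  next
    case False
    then have hP: "h v \<in> P" using nonneg[of v] v by (auto simp: P_def order_less_le)
    obtain i where i: "t (Suc i) \<le> h v" "h v < t (Suc (Suc i))"
      using dyadic_scale[OF eps P_ge[OF hP]] unfolding t_def by blast
    have "t (Suc i) < t (Suc (Suc n))"
      using i n(2) Max_ge[OF P(1) hP] unfolding t_def by linarith
    then have "i < Suc n" using \<open>mono t\<close> by (meson Suc_less_eq mono_strict_invE)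
    have "(h v)\<^sup>2 \<le> (4 * t i)\<^sup>2"
      using i t nonneg[of v] by (intro power_mono) auto
    also have "\<dots> = of_bool (v \<in> A i) * (16 * (t i)\<^sup>2)"
      using i v by (simp add: A_def power_mult_distrib)
    also have "\<dots> \<le> (\<Sum>i<Suc n. of_bool (v \<in> A i) * (16 * (t i)\<^sup>2))"
      using \<open>i < Suc n\<close> by (intro member_le_sum) auto
    finally show ?thesis .
  qed
  have volA: "vol K (A i) = (\<Sum>v\<in>?V. ?d v * of_bool (v \<in> A i))" for i
    unfolding vol_def using finite_verts
    by (intro sum.mono_neutral_cong_left) (auto simp: A_def)
  have "sqnorm h \<le> (\<Sum>v\<in>?V. ?d v * (\<Sum>i<Suc n. of_bool (v \<in> A i) * (16 * (t i)\<^sup>2)))"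
    unfolding sqnorm_def by (intro sum_mono mult_left_mono layers wdegree_nonneg)
  also have "\<dots> = (\<Sum>i<Suc n. \<Sum>v\<in>?V. ?d v * (of_bool (v \<in> A i) * (16 * (t i)\<^sup>2)))"
    unfolding sum_distrib_left by (rule sum.swap)
  also have "\<dots> = (\<Sum>i<Suc n. 16 * (t i)\<^sup>2 * vol K (A i))"
    unfolding volA sum_distrib_left by (intro sum.cong refl) simp
  finally have "\<mu> * sqnorm h \<le> \<mu> * (\<Sum>i<Suc n. 16 * (t i)\<^sup>2 * vol K (A i))"
    using \<open>\<mu> > 0\<close> by simp
  with slices energy have sum_le: "(\<Sum>i<Suc n. energy (g i) (g i))
      \<le> (\<Sum>i<Suc n. 16 * \<mu> * (t i)\<^sup>2 * vol K (A i))"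
    by (simp add: sum_distrib_left mult_ac del: sum.lessThan_Suc)
  have "\<exists>i<Suc n. energy (g i) (g i) \<le> 16 * \<mu> * (t i)\<^sup>2 * vol K (A i)"
  proof (rule ccontr)
    assume "\<not> ?thesis"
    then have "(\<Sum>i<Suc n. 16 * \<mu> * (t i)\<^sup>2 * vol K (A i)) < (\<Sum>i<Suc n. energy (g i) (g i))"
      by (intro sum_strict_mono) (auto simp: not_le)
    with sum_le show False by simp
  qed
  then obtain i where i: "i < Suc n" "energy (g i) (g i) \<le> 16 * \<mu> * (t i)\<^sup>2 * vol K (A i)"
    by blast
  have "vol K (A i) \<le> vol K {v \<in> ?V. h v > 0}"
    using t(1)[of "Suc i"] by (intro vol_mono) (auto simp: A_def)
  then have vA: "vol K (A i) \<le> vol K ?V / 2" using half by simp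
  \<comment> \<open>The zero set of \<open>h\<close> lies in \<open>B i\<close> and has at least
    half of the volume, so the smaller of the two volumes is that of \<open>A i\<close>.\<close>
  have "vol K (?V - {v \<in> ?V. h v > 0}) \<le> vol K (B i)"
    using t(1)[of i] by (intro vol_mono) (auto simp: B_def)
  then have vB: "vol K ?V / 2 \<le> vol K (B i)" using half by (simp add: vol_Diff)
  have "Max P \<in> P" using P by simp
  then obtain w where w: "w \<in> ?V" "h w = Max P" by (auto simp: P_def)
  have "t (Suc i) \<le> Max P"
    using n(1) monoD[OF \<open>mono t\<close>, of "Suc i" "Suc n"] i(1) by (simp add: t_def)
  then have "A i \<noteq> {}" using w by (auto simp: A_def)
  moreover have "B i \<noteq> {}"
    using vB vol_pos[of ?V] verts_nonempty by (auto simp: vol_def)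
  moreover have "A i \<inter> B i = {}" using t[of i] by (auto simp: A_def B_def)
  moreover have "g i v = t i" if "v \<in> A i" for v
    using that t[of i] by (auto simp: A_def g_def min_def)
  moreover have "g i v = 0" if "v \<in> B i" for v
    using that t[of i] by (auto simp: B_def g_def min_def)
  moreover have "energy (g i) (g i) \<le> 16 * \<mu> * (t i)\<^sup>2 * min (vol K (A i)) (vol K (B i))"
    using i(2) vA vB by (simp add: min_absorb1)
  ultimately show ?thesis using that[of "A i" "B i" "t i" "g i"] t(1)[of i]
    by (auto simp: A_def B_def)
qed

text \<open>For \<open>f - m\<close> with \<open>m\<close> a median, the squared norms of the two
  parts add up to at least 1 and their energies to at most the spectral gap, so some nonzero part
  has a small Rayleigh quotient.\<close>

lemma low_energy_half_support:
  obtains h where "\<And>v. h v \<ge> 0" "\<exists>v\<in>verts K. h v \<noteq> 0"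
    and "vol K {v \<in> verts K. h v > 0} \<le> vol K (verts K) / 2"
    and "energy h h \<le> spectral_gap K * sqnorm h"
proof -
  let ?V = "verts K" and ?\<mu> = "spectral_gap K"
  obtain f where f: "(\<Sum>v\<in>?V. wdegree K v * f v) = 0" "sqnorm f = 1" "energy f f = ?\<mu>"
    using spectral_gap_variational by blast
  obtain m where m: "vol K {v \<in> ?V. f v < m} \<le> vol K ?V / 2"
      "vol K {v \<in> ?V. f v > m} \<le> vol K ?V / 2"
    using median_exists by blast
  define h where "h = (\<lambda>s v. max (if s then f v - m else m - f v) 0)"
  \<comment> \<open>For \<open>x\<close> and \<open>y\<close> of opposite signs the left side is
    \<open>x^2 + y^2\<close>, and \<open>x * y \<le> 0\<close>; otherwise both sides agree.\<close>
  have "(\<Sum>s\<in>UNIV. (max (if s then x else - x) 0 - max (if s then y else - y) 0)\<^sup>2) \<le> (x - y)\<^sup>2"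
    for x y :: real
    using mult_nonneg_nonpos[of x y] mult_nonneg_nonpos2[of y x]
    by (auto simp: UNIV_bool max_def power2_eq_square algebra_simps)
  from energy_truncations_le[OF this, of "\<lambda>v. f v - m"]
  have "energy (h True) (h True) + energy (h False) (h False) \<le> energy f f"
    by (simp add: UNIV_bool h_def energy_shift if_distrib add.commute cong: if_cong)
  moreover have "1 \<le> sqnorm (h True) + sqnorm (h False)"
  proof -
    have "sqnorm (h True) + sqnorm (h False) = sqnorm (\<lambda>v. f v - m)"
      unfolding sqnorm_def h_def sum.distrib[symmetric]
      by (intro sum.cong refl) (auto simp: max_def power2_eq_square algebra_simps)
    then show ?thesis using sqnorm_shift[OF f(1), of m] f(2) vol_nonneg[of ?V] by simp
  qed
  ultimately have sum_le: "energy (h True) (h True) + energy (h False) (h False)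
      \<le> ?\<mu> * sqnorm (h True) + ?\<mu> * sqnorm (h False)" and pos: "0 < sqnorm (h True) + sqnorm (h False)"
    using f(3) spectral_gap_pos by (auto simp flip: distrib_left intro: order_trans)
  \<comment> \<open>Positive norm is demanded as well, since a vanishing part satisfies the energy
    bound trivially.\<close>
  have "\<exists>s. energy (h s) (h s) \<le> ?\<mu> * sqnorm (h s) \<and> sqnorm (h s) > 0"
  proof (rule ccontr)
    assume none: "\<not> ?thesis"
    have "?\<mu> * sqnorm (h s) \<le> energy (h s) (h s)" for s
      using none energy_nonneg[of "h s"] spectral_gap_pos sqnorm_nonneg[of "h s"]
      by (cases "sqnorm (h s) = 0") (auto simp: not_le order_less_le)
    moreover have "\<exists>s. sqnorm (h s) > 0"
      using pos sqnorm_nonneg by (metis add_nonpos_nonpos not_le)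
    then have "\<exists>s. ?\<mu> * sqnorm (h s) < energy (h s) (h s)"
      using none by (auto simp: not_le)
    ultimately show False using sum_le by (metis (full_types) add_less_le_mono add_le_less_mono not_le)
  qed
  then obtain s where s: "energy (h s) (h s) \<le> ?\<mu> * sqnorm (h s)" "sqnorm (h s) > 0" by blast
  have "{v \<in> ?V. h s v > 0} = (if s then {v \<in> ?V. f v > m} else {v \<in> ?V. f v < m})"
    by (auto simp: h_def)
  then have "vol K {v \<in> ?V. h s v > 0} \<le> vol K ?V / 2" using m by simp
  moreover have "\<exists>v\<in>?V. h s v \<noteq> 0" using s(2) by (auto simp: sqnorm_def intro: ccontr)
  moreover have "h s v \<ge> 0" for v by (simp add: h_def)
  ultimately show ?thesis using s(1) that by blast
qed

text \<open>The Poincare inequality for \<open>f - c\<close>, with \<open>c\<close> the weighted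
  mean and the norm restricted to \<open>S1\<close> and \<open>S2\<close>. The factor 2 comes from
  \<open>(\<alpha> - \<beta>)^2 \<le> 2 * ((\<alpha> - c)^2 + (\<beta> - c)^2)\<close>.\<close>

lemma potential_gap_bound:
  assumes "S1 \<subseteq> verts K" "S2 \<subseteq> verts K" "S1 \<noteq> {}" "S2 \<noteq> {}" "S1 \<inter> S2 = {}"
    and "\<And>v. v \<in> S1 \<Longrightarrow> f v = \<alpha>" "\<And>v. v \<in> S2 \<Longrightarrow> f v = \<beta>"
  shows "spectral_gap K * min (vol K S1) (vol K S2) * (\<alpha> - \<beta>)\<^sup>2 \<le> 2 * energy f f"
proof -
  let ?V = "verts K" and ?d = "wdegree K" and ?m = "min (vol K S1) (vol K S2)"
  define c where "c = (\<Sum>v\<in>?V. ?d v * f v) / vol K ?V"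
  have "vol K ?V > 0" using vol_pos verts_nonempty by blast
  then have "(\<Sum>v\<in>?V. ?d v * (f v - c)) = 0"
    unfolding right_diff_distrib sum_subtractf sum_distrib_right[symmetric] vol_def[symmetric]
    by (simp add: c_def)
  from spectral_gap_le[OF this]
  have le: "spectral_gap K * sqnorm (\<lambda>v. f v - c) \<le> energy f f" by (simp add: energy_shift)
  have fin: "finite S1" "finite S2" using assms(1,2) finite_verts finite_subset by auto
  have "(\<alpha> - \<beta>)\<^sup>2 / 2 \<le> (\<alpha> - c)\<^sup>2 + (\<beta> - c)\<^sup>2"
  proof -
    have "0 \<le> ((\<alpha> - c) + (\<beta> - c))\<^sup>2" by simp
    then show ?thesis by (simp add: power2_eq_square field_simps)
  qed
  then have "?m * ((\<alpha> - \<beta>)\<^sup>2 / 2) \<le> ?m * ((\<alpha> - c)\<^sup>2 + (\<beta> - c)\<^sup>2)"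
    by (intro mult_left_mono) (auto simp: vol_nonneg)
  also have "\<dots> \<le> vol K S1 * (\<alpha> - c)\<^sup>2 + vol K S2 * (\<beta> - c)\<^sup>2"
    unfolding distrib_left by (intro add_mono mult_right_mono) auto
  also have "\<dots> = (\<Sum>v\<in>S1 \<union> S2. ?d v * (f v - c)\<^sup>2)"
    using assms fin by (simp add: vol_def sum.union_disjoint sum_distrib_right)
  also have "\<dots> \<le> sqnorm (\<lambda>v. f v - c)"
    unfolding sqnorm_def using assms(1,2)
    by (intro sum_mono2 finite_verts) (auto intro!: mult_nonneg_nonneg wdegree_nonneg)
  finally have "spectral_gap K * (?m * ((\<alpha> - \<beta>)\<^sup>2 / 2)) \<le> spectral_gap K * sqnorm (\<lambda>v. f v - c)"
    using spectral_gap_pos by simp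
  with le show ?thesis by simp
qed

end

section \<open>Effective resistance as the energy of a potential\<close>

context oriented_graph
begin

lemma oriented_graph_identify:
  "oriented_graph (identify K S1 S2) (\<lambda>e. ident S1 S2 (p e)) (\<lambda>e. ident S1 S2 (q e))"
proof
  have adj: "adjacent (identify K S1 S2) (ident S1 S2 u) (ident S1 S2 v)" if "adjacent K u v" for u v
    using that unfolding adjacent_def identify_def by auto
  have "(adjacent (identify K S1 S2))\<^sup>*\<^sup>* (ident S1 S2 u) (ident S1 S2 v)"
    if "(adjacent K)\<^sup>*\<^sup>* u v" for u v
    using that by induction (auto dest: adj intro: rtranclp.rtrancl_into_rtrancl)
  with connected show "connected_graph (identify K S1 S2)"
    unfolding connected_graph_def by (auto simp: identify_def)
qed (use finite_verts finite_edges verts_nonempty in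
    \<open>auto simp: identify_def ends_eq p_in_verts q_in_verts wt_pos\<close>)

text \<open>The solution of \<open>L x = \<chi>\<close> on the identified graph is pulled back to
  \<open>K\<close>, which preserves energies. The last property is summation by parts against
  \<open>\<chi>\<close>; for \<open>g = f\<close> it expresses the resistance as the potential
  difference.\<close>

lemma Reff_potential:
  assumes "S1 \<subseteq> verts K" "S2 \<subseteq> verts K" "S1 \<noteq> {}" "S2 \<noteq> {}" "S1 \<inter> S2 = {}"
  obtains f \<alpha> \<beta> where "\<And>v. v \<in> S1 \<Longrightarrow> f v = \<alpha>" "\<And>v. v \<in> S2 \<Longrightarrow> f v = \<beta>"
    and "energy f f = Reff K S1 S2"
    and "\<And>g \<gamma> \<delta>. (\<And>v. v \<in> S1 \<Longrightarrow> g v = \<gamma>) \<Longrightarrow> (\<And>v. v \<in> S2 \<Longrightarrow> g v = \<delta>) \<Longrightarrow>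
      energy g f = \<gamma> - \<delta>"
proof -
  let ?H = "identify K S1 S2" and ?i = "ident S1 S2"
  interpret H: oriented_graph ?H "\<lambda>e. ?i (p e)" "\<lambda>e. ?i (q e)"
    by (rule oriented_graph_identify)
  have i: "?i v = S1" if "v \<in> S1" for v using that by (simp add: ident_def)
  have i': "?i v = S2" if "v \<in> S2" for v using that assms(5) by (auto simp: ident_def)
  have SH: "S1 \<in> verts ?H" "S2 \<in> verts ?H"
  proof -
    obtain u v where "u \<in> S1" "v \<in> S2" using assms(3,4) by blast
    then show "S1 \<in> verts ?H" "S2 \<in> verts ?H"
      using assms(1,2) i[of u] i'[of v] by (auto simp: identify_def)
  qed
  define \<chi> :: "'v set \<Rightarrow> real" where "\<chi> = (\<lambda>s. of_bool (s = S1) - of_bool (s = S2))"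
  have \<chi>: "(\<Sum>s\<in>verts ?H. y s * \<chi> s) = y S1 - y S2" for y
    using SH H.finite_verts
    by (simp add: \<chi>_def right_diff_distrib sum_subtractf sum_of_bool_mult)
  have "sum \<chi> (verts ?H) = 0" using \<chi>[of "\<lambda>_. 1"] by simp
  then obtain x where x: "\<And>u. u \<in> verts ?H \<Longrightarrow> H.lap x u = \<chi> u"
    and Reff: "(\<Sum>s\<in>verts ?H. \<Sum>t\<in>verts ?H.
      \<chi> s * pinv (verts ?H) (laplacian ?H) s t * \<chi> t) = H.energy x x"
    using H.pinv_quadratic_form by blast
  have energy_H: "H.energy y z = energy (\<lambda>v. y (?i v)) (\<lambda>v. z (?i v))" for y z
    unfolding H.energy_def energy_def by (simp add: identify_def)
  show ?thesis
  proof (rule that[of "\<lambda>v. x (?i v)" "x S1" "x S2"])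
    show "energy (\<lambda>v. x (?i v)) (\<lambda>v. x (?i v)) = Reff K S1 S2"
      using Reff by (simp add: Reff_def \<chi>_def Let_def energy_H)
  next
    fix g :: "'v \<Rightarrow> real" and \<gamma> \<delta>
    assume g: "\<And>v. v \<in> S1 \<Longrightarrow> g v = \<gamma>" "\<And>v. v \<in> S2 \<Longrightarrow> g v = \<delta>"
    \<comment> \<open>\<open>g\<close> descends to the identified graph: it is constant on
      \<open>S1\<close> and on \<open>S2\<close>, and all other vertices there are singletons, so
      the choice of representative is immaterial.\<close>
    define y where "y = (\<lambda>T. g (SOME v. v \<in> T))"
    have y1: "y S1 = \<gamma>" using assms(3) by (simp add: y_def g some_in_eq)
    have y2: "y S2 = \<delta>" using assms(4) by (simp add: y_def g some_in_eq)
    have "y (?i v) = g v" for v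
      using y1 y2 g i i' by (cases "v \<in> S1"; cases "v \<in> S2") (auto simp: ident_def y_def)
    then have "energy g (\<lambda>v. x (?i v)) = H.energy y x" by (simp add: energy_H)
    also have "\<dots> = (\<Sum>s\<in>verts ?H. y s * H.lap x s)" by (rule H.sum_lap[symmetric])
    also have "\<dots> = \<gamma> - \<delta>" using x \<chi>[of y] y1 y2 by simp
    finally show "energy g (\<lambda>v. x (?i v)) = \<gamma> - \<delta>" .
  qed (simp_all add: i i')
qed

end

section \<open>The two resistance bounds\<close>

lemma weighted_graph_orientation:
  assumes "weighted_graph G" "connected_graph G" "card (verts G) \<ge> 2"
  obtains p q where "nontrivial_graph G p q"
proof -
  have "\<forall>e\<in>edges G. \<exists>a b. ends G e = {a, b}"
    using assms(1) by (metis card_2_iff weighted_graph_def)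
  then obtain p q where pq: "\<And>e. e \<in> edges G \<Longrightarrow> ends G e = {p e, q e}" by metis
  have "nontrivial_graph G p q"
  proof
    show "verts G \<noteq> {}" using assms(3) by auto
    show "p e \<in> verts G" "q e \<in> verts G" if "e \<in> edges G" for e
      using assms(1) pq[OF that] that by (auto simp: weighted_graph_def)
  qed (use assms pq in \<open>auto simp: weighted_graph_def\<close>)
  then show ?thesis using that by blast
qed

theorem theorem1p3:
  fixes G :: "('v, 'e) wgraph"
  assumes "weighted_graph G"
    and "connected_graph G"
    and "card (verts G) \<ge> 2"
  shows "(\<exists>S1 S2. S1 \<subseteq> verts G \<and> S2 \<subseteq> verts G \<and> S1 \<noteq> {} \<and> S2 \<noteq> {} \<and> S1 \<inter> S2 = {} \<and>
            Reff G S1 S2 \<ge> 1 / (25600 * spectral_gap G * min (vol G S1) (vol G S2))) \<and>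
         (\<forall>S1' S2'. S1' \<subseteq> verts G \<and> S2' \<subseteq> verts G \<and> S1' \<noteq> {} \<and> S2' \<noteq> {} \<and> S1' \<inter> S2' = {} \<longrightarrow>
            Reff G S1' S2' \<le> 2 / (spectral_gap G * min (vol G S1') (vol G S2')))"
proof -
  obtain p q where "nontrivial_graph G p q"
    using weighted_graph_orientation[OF assms] by blast
  then interpret nontrivial_graph G p q .
  let ?\<mu> = "spectral_gap G"
  have lower: "\<exists>S1 S2. S1 \<subseteq> verts G \<and> S2 \<subseteq> verts G \<and> S1 \<noteq> {} \<and> S2 \<noteq> {} \<and> S1 \<inter> S2 = {} \<and>
            Reff G S1 S2 \<ge> 1 / (25600 * ?\<mu> * min (vol G S1) (vol G S2))"
  proof -
    obtain h where h: "\<And>v. h v \<ge> 0" "\<exists>v\<in>verts G. h v \<noteq> 0"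
      "vol G {v \<in> verts G. h v > 0} \<le> vol G (verts G) / 2" "energy h h \<le> ?\<mu> * sqnorm h"
      using low_energy_half_support by blast
    obtain S1 S2 g \<alpha> where S: "S1 \<subseteq> verts G" "S2 \<subseteq> verts G" "S1 \<noteq> {}" "S2 \<noteq> {}" "S1 \<inter> S2 = {}"
      and g: "\<alpha> > 0" "\<And>v. v \<in> S1 \<Longrightarrow> g v = \<alpha>" "\<And>v. v \<in> S2 \<Longrightarrow> g v = 0"
      and gE: "energy g g \<le> 16 * ?\<mu> * \<alpha>\<^sup>2 * min (vol G S1) (vol G S2)"
      using level_cut_exists[OF h spectral_gap_pos] by metis
    obtain f where f: "energy f f = Reff G S1 S2" "energy g f = \<alpha> - 0"
      using Reff_potential[OF S] g(2,3) by metis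
    let ?m = "min (vol G S1) (vol G S2)"
    have m: "?m > 0" using S vol_pos by simp
    have R: "Reff G S1 S2 \<ge> 0" using energy_nonneg[of f] f(1) by simp
    \<comment> \<open>Cauchy-Schwarz for the slice \<open>g\<close> against the unit-current
      potential \<open>f\<close>, whose mutual energy is \<open>\<alpha>\<close>.\<close>
    have "\<alpha>\<^sup>2 \<le> energy g g * Reff G S1 S2"
      using energy_Cauchy_Schwarz[of g f] f by simp
    also have "\<dots> \<le> (16 * ?\<mu> * \<alpha>\<^sup>2 * ?m) * Reff G S1 S2"
      using gE R by (intro mult_right_mono)
    also have "\<dots> = \<alpha>\<^sup>2 * (16 * ?\<mu> * ?m * Reff G S1 S2)" by simp
    finally have "1 \<le> 16 * ?\<mu> * ?m * Reff G S1 S2" using g(1) by simp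
    also have "\<dots> \<le> 25600 * ?\<mu> * ?m * Reff G S1 S2"
      using spectral_gap_pos m R by (intro mult_right_mono) auto
    finally have "1 / (25600 * ?\<mu> * ?m) \<le> Reff G S1 S2"
      using spectral_gap_pos m by (simp add: divide_le_eq mult_ac)
    with S show ?thesis by blast
  qed
  have upper: "Reff G S1 S2 \<le> 2 / (?\<mu> * min (vol G S1) (vol G S2))"
    if S: "S1 \<subseteq> verts G" "S2 \<subseteq> verts G" "S1 \<noteq> {}" "S2 \<noteq> {}" "S1 \<inter> S2 = {}" for S1 S2
  proof -
    obtain f \<alpha> \<beta> where f: "\<And>v. v \<in> S1 \<Longrightarrow> f v = \<alpha>" "\<And>v. v \<in> S2 \<Longrightarrow> f v = \<beta>"
      and fE: "energy f f = Reff G S1 S2" "energy f f = \<alpha> - \<beta>"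
      using Reff_potential[OF S] by metis
    let ?m = "min (vol G S1) (vol G S2)"
    have m: "?m > 0" using S vol_pos by simp
    have R: "Reff G S1 S2 \<ge> 0" using energy_nonneg[of f] fE(1) by simp
    have "?\<mu> * ?m * (Reff G S1 S2)\<^sup>2 \<le> 2 * Reff G S1 S2"
      using potential_gap_bound[OF S, of f \<alpha> \<beta>] f fE by simp
    then have "Reff G S1 S2 * (?\<mu> * ?m * Reff G S1 S2) \<le> Reff G S1 S2 * 2"
      by (simp add: power2_eq_square mult_ac)
    \<comment> \<open>Cancelling a factor \<open>Reff G S1 S2\<close> requires it to be positive; if
      it is zero, the bound is immediate.\<close>
    then have "Reff G S1 S2 = 0 \<or> ?\<mu> * ?m * Reff G S1 S2 \<le> 2"
      using R by (auto simp: mult_le_cancel_left)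
    then show ?thesis
      using spectral_gap_pos m by (auto simp: le_divide_eq mult_ac)
  qed
  show ?thesis using lower upper by blast
qed

end
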